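(* Let $K$ be a nontrivial finitely generated abelian group, decomposed as a direct product of cyclic groups $K=\mathbb{Z}^{n_1}\times(C_{r_1}\times\ldots\times C_{r_{n_2}})$ with $n_1,n_2\ge 0$ and $n:=n_1+n_2=r(K)$, the rank (minimal number of generators) of $K$. Let $X=(X_i)_{i\ge0}$ be a sequence of finite sets, and for every $i\ge 0$ let $\pi_{1,i},\ldots,\pi_{n,i},\sigma_{1,i},\ldots,\sigma_{n,i}$ be $2n$ pairwise disjoint cycles in the symmetric group on $X_i$ such that: for each $1\le s\le n$ the lengths of the cycles $\pi_{s,i}$ ($i\ge0$) are not uniformly bounded; for each $1\le s\le n_1$ the lengths of the cycles $\sigma_{s,i}$ ($i\ge 0$) are not uniformly bounded; and for each $n_1<s\le n$ and each $i\ge0$ the cycle $\sigma_{s,i}$ has length $r_{s-n_1}$. For all $1\le s\le n$, $i\ge 0$ let $x_{s,i}\in X_i$ be a letter belonging to the cycle $\pi_{s,i}$. Put $\alpha_i=\pi_{1,i}\cdot\ldots\cdot\pi_{n,i}$ and $\beta_{s,i}=\sigma_{s,i}\cdot\alpha_i$. Let $\mathcal{A}=(X,Q,\varphi^{\mathcal{A}},\psi)$ be the time-varying automaton over the changing alphabet $X$ with set of $n+1$ distinct states $Q=\{a,b_1,\ldots,b_n\}$ and, for $i\ge0$, $q\in Q$, $x\in X_i$, $$\varphi^{\mathcal{A}}_i(q,x)=\begin{cases}a,& q=b_s,\ x=x_{s,i},\ 1\le s\le n,\\ q,&\text{otherwise},\end{cases}\qquad \psi_i(q,x)=\begin{cases}\alpha_i(x),&q=a,\\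 \beta_{s,i}(x),&q=b_s,\ 1\le s\le n.\end{cases}$$ Then the automaton $\mathcal{A}$ is self-similar, and the group $G(\mathcal{A})$ is isomorphic with the lamplighter group $K\wr\mathbb{Z}$.
   Context: A changing alphabet is an infinite sequence $X=(X_i)_{i\ge 0}$ of finite sets (alphabets). For $k\ge 0$ put $X_{(k)}=(X_{k+i})_{i\ge 0}$; $X_{(k)}^*$ is the tree consisting of the empty word $\epsilon$ and all finite words $x_0x_1\ldots x_m$ ($m\ge 0$) with $x_j\in X_{k+j}$; $X^*=X^*_{(0)}$. A time-varying automaton over $X$ is a quadruple $A=(X,Q,\varphi,\psi)$, where $Q$ is a finite set (of states), $\varphi=(\varphi_i)_{i\ge0}$ and $\psi=(\psi_i)_{i\ge0}$ are sequences of functions $\varphi_i\colon Q\times X_i\to Q$ (transition functions) and $\psi_i\colon Q\times X_i\to X_i$ (output functions). It is invertible if for all $i\ge0$ and $q\in Q$ the map $x\mapsto\psi_i(q,x)$ is a permutation of $X_i$. For $k\ge 0$, the $k$-th shift of $A$ is the automaton $A_k=(X_{(k)},Q,(\varphi_{k+i})_{i\ge0},(\psi_{k+i})_{i\ge 0})$. For $q\in Q$ and $k\ge0$, the transformation $q_k\colon X_{(k)}^*\to X_{(k)}^*$ is defined recursively by $q_k(\epsilon)=\epsilon$ and $q_k(xw)=\psi_k(q,x)\,q'_{k+1}(w)$ with $q'=\varphi_k(q,x)$, for $x\in X_k$, $w\in X_{(k+1)}^*$. If $A$ is invertible, each $q_k$ is an automorphism of the rooted tree $X_{(k)}^*$,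 and $G(A_k)=\langle q_k : q\in Q\rangle$ denotes the group generated by these transformations under composition; $G(A)=G(A_0)$. Compositions (also of permutations) are written with the right action convention: $fg(w)=g(f(w))$. An invertible time-varying automaton $A$ is self-similar if for every $k\ge 0$ the mapping $q_k\mapsto q_0$ ($q\in Q$) induces (i.e. extends to) a group isomorphism $G(A_k)\simeq G(A)$. $C_r$ is the cyclic group of order $r$. The lamplighter group $K\wr\mathbb{Z}$ is the semidirect product $\bigoplus_{\mathbb{Z}}K\rtimes\mathbb{Z}$ in which the infinite cyclic group acts on the direct sum $\bigoplus_{\mathbb{Z}}K$ by the shift. *)

theory Defs
  imports
    "HOL-Algebra.Product_Groups"
    "HOL-Algebra.Bij"
    "HOL-Combinatorics.Cycles"
begin

section \<open>Words over a changing alphabet\<close>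

definition shift_seq :: "nat \<Rightarrow> (nat \<Rightarrow> 'a) \<Rightarrow> nat \<Rightarrow> 'a" where
  "shift_seq k X = (\<lambda>i. X (k + i))"

definition words :: "(nat \<Rightarrow> 'x set) \<Rightarrow> 'x list set" where
  "words X = {w. \<forall>j < length w. w ! j \<in> X j}"

text \<open>
  The symmetric group on \<open>words X\<close>. Products are read from left to right (right action
  convention), so this is the opposite of the multiplication of \<^const>\<open>BijGroup\<close>.
\<close>

definition word_group :: "(nat \<Rightarrow> 'x set) \<Rightarrow> ('x list \<Rightarrow> 'x list) monoid" where
  "word_group X =
     \<lparr>carrier = Bij (words X),
      monoid.mult = (\<lambda>f g. compose (words X) g f),
      one = (\<lambda>w \<in> words X. w)\<rparr>"


section \<open>Time-varying automata\<close>

record ('q, 'x) tv_automaton =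
  alphabet :: "nat \<Rightarrow> 'x set"
  states :: "'q set"
  trans_fun :: "nat \<Rightarrow> 'q \<Rightarrow> 'x \<Rightarrow> 'q"
  out_fun :: "nat \<Rightarrow> 'q \<Rightarrow> 'x \<Rightarrow> 'x"

definition is_tv_automaton :: "('q, 'x) tv_automaton \<Rightarrow> bool" where
  "is_tv_automaton A \<longleftrightarrow>
     (\<forall>i. finite (alphabet A i)) \<and> finite (states A) \<and>
     (\<forall>i. \<forall>q \<in> states A. \<forall>x \<in> alphabet A i.
        trans_fun A i q x \<in> states A \<and> out_fun A i q x \<in> alphabet A i)"

definition invertible_automaton :: "('q, 'x) tv_automaton \<Rightarrow> bool" where
  "invertible_automaton A \<longleftrightarrow>
     (\<forall>i. \<forall>q \<in> states A. bij_betw (out_fun A i q) (alphabet A i) (alphabet A i))"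

definition shift_automaton :: "nat \<Rightarrow> ('q, 'x) tv_automaton \<Rightarrow> ('q, 'x) tv_automaton" where
  "shift_automaton k A =
     \<lparr>alphabet = shift_seq k (alphabet A), states = states A,
      trans_fun = shift_seq k (trans_fun A), out_fun = shift_seq k (out_fun A)\<rparr>"

fun run :: "('q, 'x) tv_automaton \<Rightarrow> nat \<Rightarrow> 'q \<Rightarrow> 'x list \<Rightarrow> 'x list" where
  "run A k q [] = []"
| "run A k q (x # w) = out_fun A k q x # run A (Suc k) (trans_fun A k q x) w"

text \<open>The transformation \<open>q\<^sub>k\<close>, made extensional so that it is an element of \<^const>\<open>word_group\<close>.\<close>

definition transf :: "('q, 'x) tv_automaton \<Rightarrow> nat \<Rightarrow> 'q \<Rightarrow> 'x list \<Rightarrow> 'x list" where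
  "transf A k q = (\<lambda>w \<in> words (shift_seq k (alphabet A)). run A k q w)"

definition automaton_group :: "('q, 'x) tv_automaton \<Rightarrow> ('x list \<Rightarrow> 'x list) monoid" where
  "automaton_group A = subgroup_generated (word_group (alphabet A)) (transf A 0 ` states A)"

definition self_similar :: "('q, 'x) tv_automaton \<Rightarrow> bool" where
  "self_similar A \<longleftrightarrow>
     is_tv_automaton A \<and> invertible_automaton A \<and>
     (\<forall>k. \<exists>h \<in> iso (automaton_group (shift_automaton k A)) (automaton_group A).
        \<forall>q \<in> states A. h (transf A k q) = transf A 0 q)"


section \<open>Group-theoretic notions\<close>

definition fin_gen_group :: "('g, 'm) monoid_scheme \<Rightarrow> bool" where
  "fin_gen_group G \<longleftrightarrow> (\<exists>S. finite S \<and> S \<subseteq> carrier G \<and> generate G S = carrier G)"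

text \<open>Meaningful for finitely generated groups only.\<close>

definition group_rank :: "('g, 'm) monoid_scheme \<Rightarrow> nat" where
  "group_rank G =
     (LEAST m. \<exists>S. finite S \<and> card S = m \<and> S \<subseteq> carrier G \<and> generate G S = carrier G)"

definition semidirect ::
  "('n, 'c) monoid_scheme \<Rightarrow> ('h, 'd) monoid_scheme \<Rightarrow> ('h \<Rightarrow> 'n \<Rightarrow> 'n) \<Rightarrow> ('n \<times> 'h) monoid" where
  "semidirect N H \<theta> =
     \<lparr>carrier = carrier N \<times> carrier H,
      monoid.mult = (\<lambda>(f, m) (g, p). (f \<otimes>\<^bsub>N\<^esub> \<theta> m g, m \<otimes>\<^bsub>H\<^esub> p)),
      one = (\<one>\<^bsub>N\<^esub>, \<one>\<^bsub>H\<^esub>)\<rparr>"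

definition lamplighter :: "('k, 'm) monoid_scheme \<Rightarrow> ((int \<Rightarrow> 'k) \<times> int) monoid" where
  "lamplighter K =
     semidirect (sum_group UNIV (\<lambda>_::int. K)) integer_group (\<lambda>m f i. f (i - m))"


section \<open>Products of permutations\<close>

text \<open>The product \<open>p 1 \<cdot> \<dots> \<cdot> p n\<close> in the right action convention: \<open>p 1\<close> is applied first.\<close>

definition perm_prod :: "nat \<Rightarrow> (nat \<Rightarrow> 'x \<Rightarrow> 'x) \<Rightarrow> 'x \<Rightarrow> 'x" where
  "perm_prod n p = foldr (\<lambda>s f. f \<circ> p s) [1..<Suc n] id"


section \<open>Basic facts\<close>

lemma words_Nil [simp]: "[] \<in> words X"
  by (simp add: words_def)

lemma words_Cons [simp]: "x # w \<in> words X \<longleftrightarrow> x \<in> X 0 \<and> w \<in> words (shift_seq 1 X)"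
  by (auto simp: words_def shift_seq_def nth_Cons split: nat.splits)

lemma shift_seq_shift_seq [simp]: "shift_seq j (shift_seq k X) = shift_seq (k + j) X"
  by (simp add: shift_seq_def add.assoc)

lemma shift_seq_0 [simp]: "shift_seq 0 X = X"
  by (simp add: shift_seq_def)

lemma shift_seq_at_0 [simp]: "shift_seq k X 0 = X k"
  by (simp add: shift_seq_def)

lemma run_shift: "run (shift_automaton k A) j q w = run A (k + j) q w"
  by (induction w arbitrary: j q) (auto simp: shift_automaton_def shift_seq_def)

lemma transf_shift: "transf (shift_automaton k A) j q = transf A (k + j) q"
  by (simp add: transf_def run_shift) (simp add: shift_automaton_def)

lemma automaton_group_shift:
  "automaton_group (shift_automaton k A) =
     subgroup_generated (word_group (shift_seq k (alphabet A))) (transf A k ` states A)"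
proof -
  have "transf (shift_automaton k A) 0 = transf A k"
    by (rule ext) (simp add: transf_shift)
  then show ?thesis
    by (simp add: automaton_group_def) (simp add: shift_automaton_def)
qed

lemma group_word_group: "group (word_group X)"
proof (rule groupI)
  fix f assume "f \<in> carrier (word_group X)"
  then have f: "f \<in> Bij (words X)" by (simp add: word_group_def)
  have "compose (words X) f (restrict (inv_into (words X) f) (words X)) = (\<lambda>w \<in> words X. w)"
    using f by (auto simp: Bij_def compose_def bij_betw_def inv_into_into f_inv_into_f)
  then show "\<exists>g \<in> carrier (word_group X). g \<otimes>\<^bsub>word_group X\<^esub> f = \<one>\<^bsub>word_group X\<^esub>"
    using f restrict_inv_into_Bij by (auto simp: word_group_def)
qed (auto simp: word_group_def compose_Bij id_Bij Bij_imp_funcset Bij_imp_extensional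
       compose_assoc [symmetric]
       compose_Id [OF Bij_imp_funcset Bij_imp_extensional])

lemma bij_betw_run:
  assumes "is_tv_automaton A" "invertible_automaton A" "q \<in> states A"
  shows "bij_betw (run A k q) (words (shift_seq k (alphabet A))) (words (shift_seq k (alphabet A)))"
proof -
  let ?W = "\<lambda>k. words (shift_seq k (alphabet A))"
  have cl: "run A k q w \<in> ?W k" if "q \<in> states A" "w \<in> ?W k" for k q w
    using that
  proof (induction w arbitrary: k q)
    case (Cons x w)
    then show ?case using assms(1)
      by (auto simp: is_tv_automaton_def)
  qed simp
  have inj: "v = w" if "q \<in> states A" "v \<in> ?W k" "w \<in> ?W k" "run A k q v = run A k q w" for k q v w
    using that
  proof (induction v arbitrary: k q w)
    case Nil
    then show ?case by (cases w) auto
  next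
    case (Cons x v)
    then obtain y w' where w: "w = y # w'" by (cases w) auto
    have xy: "x \<in> alphabet A k" "y \<in> alphabet A k"
      using Cons.prems by (auto simp: w)
    have "x = y" using Cons.prems assms(2) xy
      by (auto simp: w invertible_automaton_def bij_betw_def dest: inj_onD)
    moreover have "v = w'"
      using Cons.prems assms(1) xy \<open>x = y\<close>
      by (intro Cons.IH[of "trans_fun A k q x" "Suc k"]) (auto simp: w is_tv_automaton_def)
    ultimately show ?case by (simp add: w)
  qed
  have surj: "\<exists>v \<in> ?W k. run A k q v = w" if "q \<in> states A" "w \<in> ?W k" for k q w
    using that
  proof (induction w arbitrary: k q)
    case Nil
    then show ?case by (intro bexI[of _ "[]"]) simp_all
  next
    case (Cons y w)
    then have "y \<in> alphabet A k"
      by simp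
    moreover have "out_fun A k q ` alphabet A k = alphabet A k"
      using assms(2) Cons.prems by (simp add: invertible_automaton_def bij_betw_def)
    ultimately obtain x where x: "x \<in> alphabet A k" "out_fun A k q x = y"
      by (metis imageE)
    then have "trans_fun A k q x \<in> states A"
      using assms(1) Cons.prems by (auto simp: is_tv_automaton_def)
    moreover have "w \<in> ?W (Suc k)"
      using Cons.prems by simp
    ultimately obtain v where "v \<in> ?W (Suc k)" "run A (Suc k) (trans_fun A k q x) v = w"
      using Cons.IH by blast
    with x show ?case
      by (intro bexI[of _ "x # v"]) auto
  qed
  show ?thesis
    unfolding bij_betw_def
  proof
    show "inj_on (run A k q) (?W k)"
      using inj assms(3) by (intro inj_onI)
    show "run A k q ` ?W k = ?W k"
    proof
      show "run A k q ` ?W k \<subseteq> ?W k"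
        using cl assms(3) by blast
      show "?W k \<subseteq> run A k q ` ?W k"
        using surj[OF assms(3)] by (metis imageI subsetI)
    qed
  qed
qed

lemma transf_in_word_group:
  assumes "is_tv_automaton A" "invertible_automaton A" "q \<in> states A"
  shows "transf A k q \<in> carrier (word_group (shift_seq k (alphabet A)))"
  using bij_betw_run[OF assms, of k]
  unfolding word_group_def transf_def Bij_def bij_betw_def
  by (simp add: inj_on_restrict_eq)

lemma group_semidirect:
  assumes "group N" "group H"
    and act: "\<And>m. m \<in> carrier H \<Longrightarrow> \<theta> m \<in> hom N N"
    and one: "\<And>f. f \<in> carrier N \<Longrightarrow> \<theta> \<one>\<^bsub>H\<^esub> f = f"
    and mult: "\<And>m p f. m \<in> carrier H \<Longrightarrow> p \<in> carrier H \<Longrightarrow> f \<in> carrier N \<Longrightarrow>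
                 \<theta> (m \<otimes>\<^bsub>H\<^esub> p) f = \<theta> m (\<theta> p f)"
  shows "group (semidirect N H \<theta>)"
proof -
  interpret N: group N by fact
  interpret H: group H by fact
  have cl: "\<theta> m f \<in> carrier N" if "m \<in> carrier H" "f \<in> carrier N" for m f
    using act that by (auto simp: hom_def)
  have hm: "\<theta> m (f \<otimes>\<^bsub>N\<^esub> g) = \<theta> m f \<otimes>\<^bsub>N\<^esub> \<theta> m g"
    if "m \<in> carrier H" "f \<in> carrier N" "g \<in> carrier N" for m f g
    using act that by (auto simp: hom_def)
  show ?thesis
  proof (rule groupI)
    fix x assume "x \<in> carrier (semidirect N H \<theta>)"
    then obtain f m where x: "x = (f, m)" "f \<in> carrier N" "m \<in> carrier H"
      by (auto simp: semidirect_def)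
    have "\<theta> (inv\<^bsub>H\<^esub> m) (inv\<^bsub>N\<^esub> f) \<otimes>\<^bsub>N\<^esub> \<theta> (inv\<^bsub>H\<^esub> m) f = \<theta> (inv\<^bsub>H\<^esub> m) \<one>\<^bsub>N\<^esub>"
      using x by (simp flip: hm)
    also have "\<dots> = \<one>\<^bsub>N\<^esub>"
      using x act[of "inv\<^bsub>H\<^esub> m"] \<open>group N\<close> by (simp add: hom_one)
    finally show "\<exists>y \<in> carrier (semidirect N H \<theta>).
        y \<otimes>\<^bsub>semidirect N H \<theta>\<^esub> x = \<one>\<^bsub>semidirect N H \<theta>\<^esub>"
      using x
      by (intro bexI[of _ "(\<theta> (inv\<^bsub>H\<^esub> m) (inv\<^bsub>N\<^esub> f), inv\<^bsub>H\<^esub> m)"])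
         (auto simp: semidirect_def cl)
  qed (auto simp: semidirect_def cl hm one mult N.m_assoc H.m_assoc)
qed

lemma group_lamplighter:
  assumes "group K"
  shows "group (lamplighter K)"
  unfolding lamplighter_def
proof (rule group_semidirect)
  show "(\<lambda>f i. f (i - m)) \<in> hom (sum_group UNIV (\<lambda>_. K)) (sum_group UNIV (\<lambda>_. K))"
    for m :: int
  proof (rule homI)
    fix f assume "f \<in> carrier (sum_group UNIV (\<lambda>_::int. K))"
    then have f: "\<And>i. f i \<in> carrier K" "finite {i. f i \<noteq> \<one>\<^bsub>K\<^esub>}"
      using assms by (auto simp: carrier_sum_group PiE_iff)
    have "{i. f (i - m) \<noteq> \<one>\<^bsub>K\<^esub>} = (\<lambda>i. i + m) ` {i. f i \<noteq> \<one>\<^bsub>K\<^esub>}"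
      by (auto simp: image_iff) (metis diff_add_cancel)
    then show "(\<lambda>i. f (i - m)) \<in> carrier (sum_group UNIV (\<lambda>_. K))"
      using f assms by (auto simp: carrier_sum_group PiE_iff)
  qed (simp add: restrict_UNIV)
qed (use assms group_integer_group in
      \<open>auto simp: integer_group_def algebra_simps simp del: group_integer_group\<close>)

end

theory Submission
  imports Defs "HOL-Library.Groups_Big_Fun" "HOL-Number_Theory.Cong"
begin

text \<open>
  In right action notation \<open>c\<^sub>s = b\<^sub>s a\<^sup>-\<^sup>1\<close> applies \<open>\<sigma>\<^sub>s\<close> to every letter of a word up to the first
  occurrence of \<open>x\<^sub>s\<close>, and its conjugate \<open>a\<^sup>m c\<^sub>s a\<^sup>-\<^sup>m\<close> does the same up to the first letter that \<open>\<alpha>\<^sup>m\<close> moves to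
  \<open>x\<^sub>s\<close>. As the cycles are disjoint, these conjugates commute, so an element of the automaton group is
  given by a shift \<open>p\<close> and finitely supported exponents \<open>F s m\<close>: it rotates letters on \<open>\<pi>\<close>-cycles by
  \<open>p\<close>, and letters on the \<open>s\<close>-th \<open>\<sigma>\<close>-cycle by the sum of those \<open>F s m\<close> for which no earlier letter is
  mapped to \<open>x\<^sub>s\<close> by \<open>\<alpha>\<^sup>m\<close>. This is an action of the lamplighter group. Long \<open>\<pi>\<close>-cycles detect \<open>p\<close> and
  separate the \<open>F s m\<close> from each other, and the \<open>\<sigma>\<close>-cycles detect \<open>F s m\<close>, so the action is faithful.
  Both facts only depend on the cycles from some level on, whence self-similarity.
\<close>

section \<open>Rotations of cycles\<close>

text \<open>For distinct \<open>cs\<close> this is the \<open>m\<close>-th power of the cycle that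
  \<open>cs\<close> lists, for any integer \<open>m\<close>. Index arithmetic makes exponents add
  and turns equality of powers into a congruence modulo the length.\<close>

definition rot :: "'x list \<Rightarrow> int \<Rightarrow> 'x \<Rightarrow> 'x" where
  "rot cs m y = (if y \<in> set cs
     then cs ! nat ((int (THE i. i < length cs \<and> cs ! i = y) + m) mod int (length cs)) else y)"

lemma rot_nth:
  assumes "distinct cs" "i < length cs"
  shows "rot cs m (cs ! i) = cs ! nat ((int i + m) mod int (length cs))"
proof -
  have "(THE j. j < length cs \<and> cs ! j = cs ! i) = i"
    using assms by (auto simp: nth_eq_iff_index_eq)
  then show ?thesis
    using assms by (simp add: rot_def)
qed

lemma rot_outside [simp]: "y \<notin> set cs \<Longrightarrow> rot cs m y = y"
  by (simp add: rot_def)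

lemma rot_index_less: "i < length cs \<Longrightarrow> nat ((int i + m) mod int (length cs)) < length cs"
  by (cases "cs = []") (simp_all add: nat_less_iff)

lemma rot_in_set_iff [simp]:
  assumes "distinct cs"
  shows "rot cs m y \<in> set cs \<longleftrightarrow> y \<in> set cs"
proof (cases "y \<in> set cs")
  case True
  then obtain i where "i < length cs" "y = cs ! i"
    by (auto simp: in_set_conv_nth)
  then show ?thesis
    using assms by (auto simp: rot_nth rot_index_less)
qed simp

lemma rot_rot:
  assumes "distinct cs"
  shows "rot cs m' (rot cs m y) = rot cs (m + m') y"
proof (cases "y \<in> set cs")
  case True
  then obtain i where i: "i < length cs" "y = cs ! i"
    by (auto simp: in_set_conv_nth)
  then have "0 < int (length cs)"
    by linarith
  then show ?thesis
    using assms i by (simp add: rot_nth rot_index_less mod_add_left_eq add.assoc)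
qed simp

lemma rot_eq_iff:
  assumes "distinct cs" "y \<in> set cs"
  shows "rot cs m y = rot cs m' y \<longleftrightarrow> [m = m'] (mod int (length cs))"
proof -
  obtain i where i: "i < length cs" "y = cs ! i"
    using assms by (auto simp: in_set_conv_nth)
  then have pos: "0 < int (length cs)"
    by linarith
  have "rot cs m y = rot cs m' y \<longleftrightarrow>
      nat ((int i + m) mod int (length cs)) = nat ((int i + m') mod int (length cs))"
    using assms i by (simp add: rot_nth nth_eq_iff_index_eq rot_index_less)
  also have "\<dots> \<longleftrightarrow> [int i + m = int i + m'] (mod int (length cs))"
    using pos by (simp add: cong_def nat_eq_iff)
  finally show ?thesis
    by (simp add: cong_add_lcancel)
qed

lemma rot_0 [simp]:
  assumes "distinct cs"
  shows "rot cs 0 y = y"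
proof (cases "y \<in> set cs")
  case True
  then obtain i where "i < length cs" "y = cs ! i"
    by (auto simp: in_set_conv_nth)
  then show ?thesis
    using assms by (simp add: rot_nth)
qed simp

lemma rot_fixed_iff:
  assumes "distinct cs" "y \<in> set cs"
  shows "rot cs m y = y \<longleftrightarrow> int (length cs) dvd m"
  using rot_eq_iff[OF assms, of m 0] assms(1) by (simp add: cong_0_iff)

text \<open>Mapping the cycle over its own list rotates the list by one place, so the entry at
  \<open>i\<close> goes to the entry at \<open>i + 1\<close> modulo the length.\<close>

lemma rot_1:
  assumes "distinct cs"
  shows "rot cs 1 y = cycle_of_list cs y"
proof (cases "y \<in> set cs")
  case True
  then obtain i where i: "i < length cs" "y = cs ! i"
    by (auto simp: in_set_conv_nth)
  have "cycle_of_list cs (cs ! i) = map (cycle_of_list cs ^^ 1) cs ! i"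
    using i by simp
  also have "\<dots> = rotate 1 cs ! i"
    using cyclic_rotation[OF assms, of 1] by simp
  also have "\<dots> = cs ! ((1 + i) mod length cs)"
    using i by (simp add: nth_rotate del: rotate_Suc)
  also have "(1 + i) mod length cs = nat ((int i + 1) mod int (length cs))"
    by (simp add: nat_mod_distrib nat_add_distrib)
  finally show ?thesis
    using assms i by (simp add: rot_nth)
qed (simp add: id_outside_supp)

section \<open>Powers of several disjoint cycles at once\<close>

definition multi_rot :: "'j set \<Rightarrow> ('j \<Rightarrow> 'x list) \<Rightarrow> ('j \<Rightarrow> int) \<Rightarrow> 'x \<Rightarrow> 'x" where
  "multi_rot J C e y = (if \<exists>j \<in> J. y \<in> set (C j)
     then let j = THE j. j \<in> J \<and> y \<in> set (C j) in rot (C j) (e j) y else y)"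

lemma multi_rot_inside:
  assumes "disjoint_family_on (\<lambda>j. set (C j)) J" "j \<in> J" "y \<in> set (C j)"
  shows "multi_rot J C e y = rot (C j) (e j) y"
proof -
  have "(THE j. j \<in> J \<and> y \<in> set (C j)) = j"
    using assms by (intro the_equality) (auto simp: disjoint_family_on_def)
  then show ?thesis
    using assms by (auto simp: multi_rot_def Let_def)
qed

lemma multi_rot_outside: "(\<And>j. j \<in> J \<Longrightarrow> y \<notin> set (C j)) \<Longrightarrow> multi_rot J C e y = y"
  by (auto simp: multi_rot_def)

section \<open>Left-to-right products of disjoint cycles\<close>

lemma perm_prod_Suc: "perm_prod (Suc n) p = p (Suc n) \<circ> perm_prod n p"
proof -
  \<comment> \<open>Peeling off the last index replaces the start value \<open>id\<close> of the
    fold by \<open>p (Suc n)\<close>; hence the start value \<open>g\<close> is arbitrary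
    here.\<close>
  have "foldr (\<lambda>s f. f \<circ> p s) xs g = g \<circ> foldr (\<lambda>s f. f \<circ> p s) xs id" for xs g
    by (induction xs arbitrary: g) (auto simp: fun_eq_iff)
  from this[of "[1..<Suc n]" "p (Suc n)"] show ?thesis
    by (simp add: perm_prod_def)
qed

lemma perm_prod_cycles_outside:
  "(\<And>s. s \<in> {1..n} \<Longrightarrow> y \<notin> set (c s)) \<Longrightarrow> perm_prod n (\<lambda>s. cycle_of_list (c s)) y = y"
proof (induction n)
  case 0
  then show ?case by (simp add: perm_prod_def)
next
  case (Suc n)
  then show ?case by (simp add: perm_prod_Suc id_outside_supp)
qed

text \<open>The factors before \<open>s\<close> fix \<open>y\<close>, and the image of
  \<open>y\<close> stays on cycle \<open>s\<close>, so the later factors fix it too.\<close>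

lemma perm_prod_cycles_inside:
  assumes "disjoint_family_on (\<lambda>s. set (c s)) {1..n}" "s \<in> {1..n}" "y \<in> set (c s)"
  shows "perm_prod n (\<lambda>s. cycle_of_list (c s)) y = cycle_of_list (c s) y"
  using assms
proof (induction n)
  case (Suc n)
  show ?case
  proof (cases "s = Suc n")
    case True
    then have "y \<notin> set (c t)" if "t \<in> {1..n}" for t
      using disjoint_family_onD[OF Suc.prems(1), of s t] Suc.prems that True by auto
    then show ?thesis
      using True perm_prod_cycles_outside[of n y c] by (simp add: perm_prod_Suc)
  next
    case False
    then have "perm_prod n (\<lambda>s. cycle_of_list (c s)) y = cycle_of_list (c s) y"
      using Suc.prems by (intro Suc.IH) (auto intro: disjoint_family_on_mono[rotated])
    moreover have "cycle_of_list (c s) y \<in> set (c s)"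
      using Suc.prems(3) by (simp add: permutes_in_image[OF cycle_permutes])
    then have "cycle_of_list (c s) y \<notin> set (c (Suc n))"
      using disjoint_family_onD[OF Suc.prems(1), of s "Suc n"] Suc.prems False by auto
    ultimately show ?thesis
      by (simp add: perm_prod_Suc id_outside_supp)
  qed
qed simp

section \<open>Lamp configurations acting on words\<close>

text \<open>
  \<open>R s\<close> is the modulus of the \<open>s\<close>-th cyclic factor; \<open>R s = 0\<close> encodes an infinite cyclic factor.
\<close>

locale lamp_cycles =
  fixes n :: nat
    and X :: "nat \<Rightarrow> 'x set"
    and \<pi> \<sigma> :: "nat \<Rightarrow> nat \<Rightarrow> 'x list"
    and x :: "nat \<Rightarrow> nat \<Rightarrow> 'x"
    and R :: "nat \<Rightarrow> int"
  assumes n_pos: "0 < n"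
    and \<pi>_cycle: "s \<in> {1..n} \<Longrightarrow> distinct (\<pi> s i) \<and> set (\<pi> s i) \<subseteq> X i"
    and \<sigma>_cycle: "s \<in> {1..n} \<Longrightarrow> distinct (\<sigma> s i) \<and> \<sigma> s i \<noteq> [] \<and> set (\<sigma> s i) \<subseteq> X i"
    and \<pi>_disj: "disjoint_family_on (\<lambda>s. set (\<pi> s i)) {1..n}"
    and \<sigma>_disj: "disjoint_family_on (\<lambda>s. set (\<sigma> s i)) {1..n}"
    and \<pi>\<sigma>_disj: "s \<in> {1..n} \<Longrightarrow> t \<in> {1..n} \<Longrightarrow> set (\<pi> s i) \<inter> set (\<sigma> t i) = {}"
    and x_in: "s \<in> {1..n} \<Longrightarrow> x s i \<in> set (\<pi> s i)"
    and \<pi>_unbounded: "s \<in> {1..n} \<Longrightarrow> \<exists>i\<ge>k. B < length (\<pi> s i)"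
    and length_\<sigma>_dvd: "s \<in> {1..n} \<Longrightarrow> int (length (\<sigma> s i)) dvd R s"
    and R_dvdI: "s \<in> {1..n} \<Longrightarrow> (\<And>i. k < i \<Longrightarrow> int (length (\<sigma> s i)) dvd c) \<Longrightarrow> R s dvd c"
begin

section \<open>The action on a single letter\<close>

definition letter :: "nat \<Rightarrow> int \<Rightarrow> (nat \<Rightarrow> int) \<Rightarrow> 'x \<Rightarrow> 'x" where
  "letter i p e = multi_rot ({1..n} <+> {1..n})
     (case_sum (\<lambda>s. \<pi> s i) (\<lambda>s. \<sigma> s i)) (case_sum (\<lambda>_. p) e)"

text \<open>The disjoint sum collects all \<open>2n\<close> cycles of a level in one family, so that
  \<open>multi_rot_inside\<close> treats \<pi>- and \<sigma>-cycles alike.\<close>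

lemma cycles_disjoint:
  "disjoint_family_on (\<lambda>j. set (case_sum (\<lambda>s. \<pi> s i) (\<lambda>s. \<sigma> s i) j)) ({1..n} <+> {1..n})"
  unfolding disjoint_family_on_def
proof (intro ballI impI)
  fix j l assume "j \<in> {1..n} <+> {1..n}" "l \<in> {1..n} <+> {1..n}" "j \<noteq> l"
  then show "set (case_sum (\<lambda>s. \<pi> s i) (\<lambda>s. \<sigma> s i) j) \<inter>
      set (case_sum (\<lambda>s. \<pi> s i) (\<lambda>s. \<sigma> s i) l) = {}"
    using disjoint_family_onD[OF \<pi>_disj[of i]] disjoint_family_onD[OF \<sigma>_disj[of i]]
      \<pi>\<sigma>_disj[of _ _ i]
    by (elim PlusE) (simp_all add: Int_commute)
qed

lemma letter_\<pi>:
  assumes "s \<in> {1..n}" "y \<in> set (\<pi> s i)"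
  shows "letter i p e y = rot (\<pi> s i) p y"
  using multi_rot_inside[OF cycles_disjoint, of "Inl s" y i "case_sum (\<lambda>_. p) e"] assms
  by (simp add: letter_def InlI InrI)

lemma letter_\<sigma>:
  assumes "s \<in> {1..n}" "y \<in> set (\<sigma> s i)"
  shows "letter i p e y = rot (\<sigma> s i) (e s) y"
  using multi_rot_inside[OF cycles_disjoint, of "Inr s" y i "case_sum (\<lambda>_. p) e"] assms
  by (simp add: letter_def InlI InrI)

lemma letter_outside:
  assumes "\<And>s. s \<in> {1..n} \<Longrightarrow> y \<notin> set (\<pi> s i)" "\<And>s. s \<in> {1..n} \<Longrightarrow> y \<notin> set (\<sigma> s i)"
  shows "letter i p e y = y"
  using assms by (auto simp: letter_def intro!: multi_rot_outside)

text \<open>The exponents are quantified inside each case because the case depends on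
  \<open>i\<close> and \<open>y\<close> alone.\<close>

lemma letter_cases:
  obtains (pi) s where "s \<in> {1..n}" "y \<in> set (\<pi> s i)" "\<And>p e. letter i p e y = rot (\<pi> s i) p y"
  | (sigma) s where "s \<in> {1..n}" "y \<in> set (\<sigma> s i)" "\<And>p e. letter i p e y = rot (\<sigma> s i) (e s) y"
  | (outside) "\<And>s. s \<in> {1..n} \<Longrightarrow> y \<notin> set (\<pi> s i)" "\<And>s. s \<in> {1..n} \<Longrightarrow> y \<notin> set (\<sigma> s i)"
      "\<And>p e. letter i p e y = y"
proof (cases "\<exists>s \<in> {1..n}. y \<in> set (\<pi> s i)")
  case True
  then show ?thesis using that(1) letter_\<pi> by blast
next
  case pi: False
  show ?thesis
  proof (cases "\<exists>s \<in> {1..n}. y \<in> set (\<sigma> s i)")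
    case True
    then show ?thesis using that(2) letter_\<sigma> by blast
  next
    case False
    with pi have "letter i p e y = y" for p e
      by (intro letter_outside) auto
    with pi False show ?thesis using that(3) by blast
  qed
qed

lemma letter_letter:
  "letter i q e' (letter i p e y) = letter i (p + q) (\<lambda>s. e s + e' s) y"
proof (cases rule: letter_cases[where y = y and i = i])
  case (pi s)
  then show ?thesis using \<pi>_cycle[of s i] by (simp add: letter_\<pi>[of s] rot_rot)
next
  case (sigma s)
  then show ?thesis using \<sigma>_cycle[of s i] by (simp add: letter_\<sigma>[of s] rot_rot)
qed simp

text \<open>The \<sigma>-lengths divide \<open>R s\<close>, so exponents matter only modulo
  \<open>R s\<close>. Integer representatives of elements of a cyclic factor can therefore serve as
  exponents.\<close>

lemma letter_cong:
  assumes "\<And>s. s \<in> {1..n} \<Longrightarrow> [e s = e' s] (mod R s)"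
  shows "letter i p e y = letter i p e' y"
proof (cases rule: letter_cases[where y = y and i = i])
  case (sigma s)
  have "[e s = e' s] (mod int (length (\<sigma> s i)))"
    using assms[OF sigma(1)] length_\<sigma>_dvd[OF sigma(1)] by (rule cong_dvd_modulus)
  then show ?thesis
    using sigma \<sigma>_cycle[of s i] by (simp add: rot_eq_iff)
qed simp_all

lemma letter_0: "letter i 0 (\<lambda>_. 0) y = y"
proof (cases rule: letter_cases[where y = y and i = i])
  case (pi s)
  then show ?thesis using \<pi>_cycle[of s i] by simp
next
  case (sigma s)
  then show ?thesis using \<sigma>_cycle[of s i] by simp
qed

lemma letter_in:
  assumes "y \<in> X i"
  shows "letter i p e y \<in> X i"
proof (cases rule: letter_cases[where y = y and i = i])
  case (pi s)
  then have "letter i p e y \<in> set (\<pi> s i)"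
    using \<pi>_cycle[of s i] by simp
  then show ?thesis using pi \<pi>_cycle[of s i] by blast
next
  case (sigma s)
  then have "letter i p e y \<in> set (\<sigma> s i)"
    using \<sigma>_cycle[of s i] by simp
  then show ?thesis using sigma \<sigma>_cycle[of s i] by blast
qed (use assms in simp)

text \<open>On the cycle rotations add. A letter off the cycle stays off it, and then both sides
  fail because \<open>x s i\<close> lies on the cycle. This is the source of the shift in the wreath
  product.\<close>

lemma rot_\<pi>_letter:
  assumes "s \<in> {1..n}"
  shows "rot (\<pi> s i) m (letter i p e y) = x s i \<longleftrightarrow> rot (\<pi> s i) (m + p) y = x s i"
proof (cases "y \<in> set (\<pi> s i)")
  case True
  then show ?thesis
    using assms \<pi>_cycle[of s i] by (simp add: letter_\<pi> rot_rot add.commute)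
next
  case False
  have "letter i p e y \<notin> set (\<pi> s i)"
  proof (cases rule: letter_cases[where y = y and i = i])
    case (pi t)
    then have "letter i p e y \<in> set (\<pi> t i)" "s \<noteq> t"
      using \<pi>_cycle[of t i] False by auto
    then show ?thesis
      using disjoint_family_onD[OF \<pi>_disj[of i] assms pi(1)] by blast
  next
    case (sigma t)
    then have "letter i p e y \<in> set (\<sigma> t i)"
      using \<sigma>_cycle[of t i] by simp
    then show ?thesis
      using \<pi>\<sigma>_disj[OF assms sigma(1), of i] by blast
  qed (use False in simp)
  then show ?thesis
    using False x_in[OF assms, of i] by auto
qed

section \<open>The action on words and its composition law\<close>

definition unhit :: "nat \<Rightarrow> nat \<Rightarrow> 'x list \<Rightarrow> nat \<Rightarrow> int \<Rightarrow> bool" where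
  "unhit k s w i m \<longleftrightarrow> (\<forall>j<i. rot (\<pi> s (k + j)) m (w ! j) \<noteq> x s (k + j))"

text \<open>The power of the \<open>s\<close>-th \<sigma>-cycle applied at position
  \<open>i\<close>: \<open>F s m\<close> is the exponent of the conjugate
  \<open>a^m c_s a^-m\<close>, counted while that conjugate is still active. The sum is 0 by default
  if infinitely many terms are nonzero, hence the finiteness assumptions below.\<close>

definition expo :: "nat \<Rightarrow> (nat \<Rightarrow> int \<Rightarrow> int) \<Rightarrow> 'x list \<Rightarrow> nat \<Rightarrow> nat \<Rightarrow> int" where
  "expo k F w i s = (\<Sum>m. if unhit k s w i m then F s m else 0)"

definition act :: "nat \<Rightarrow> (nat \<Rightarrow> int \<Rightarrow> int) \<Rightarrow> int \<Rightarrow> 'x list \<Rightarrow> 'x list" where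
  "act k F p w = map (\<lambda>i. letter (k + i) p (expo k F w i) (w ! i)) [0..<length w]"

lemma length_act [simp]: "length (act k F p w) = length w"
  by (simp add: act_def)

lemma nth_act: "i < length w \<Longrightarrow> act k F p w ! i = letter (k + i) p (expo k F w i) (w ! i)"
  by (simp add: act_def)

lemma act_in_words:
  "w \<in> words (shift_seq k X) \<Longrightarrow> act k F p w \<in> words (shift_seq k X)"
  by (auto simp: words_def shift_seq_def nth_act intro: letter_in)

lemma expo_superset:
  assumes "finite M" "{m. F s m \<noteq> 0} \<subseteq> M"
  shows "expo k F w i s = (\<Sum>m \<in> M. if unhit k s w i m then F s m else 0)"
  unfolding expo_def using assms by (intro Sum_any.expand_superset) auto

lemma expo_cong:
  assumes "finite {m. F s m \<noteq> 0}" "finite {m. G s m \<noteq> 0}" "\<And>m. [F s m = G s m] (mod r)"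
  shows "[expo k F w i s = expo k G w i s] (mod r)"
proof -
  \<comment> \<open>Congruent values may vanish at different places, so both sums run over the union
    of the supports.\<close>
  let ?M = "{m. F s m \<noteq> 0} \<union> {m. G s m \<noteq> 0}"
  have "expo k F w i s = (\<Sum>m \<in> ?M. if unhit k s w i m then F s m else 0)"
    "expo k G w i s = (\<Sum>m \<in> ?M. if unhit k s w i m then G s m else 0)"
    using assms by (auto intro!: expo_superset)
  moreover have "[(\<Sum>m \<in> ?M. if unhit k s w i m then F s m else 0)
      = (\<Sum>m \<in> ?M. if unhit k s w i m then G s m else 0)] (mod r)"
    using assms(3) by (intro cong_sum) auto
  ultimately show ?thesis by simp
qed

lemma act_cong:
  assumes "\<And>s. s \<in> {1..n} \<Longrightarrow> finite {m. F s m \<noteq> 0}" "\<And>s. s \<in> {1..n} \<Longrightarrow> finite {m. G s m \<noteq> 0}"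
    and "\<And>s m. s \<in> {1..n} \<Longrightarrow> [F s m = G s m] (mod R s)"
  shows "act k F p = act k G p"
  unfolding act_def using assms by (intro ext map_cong letter_cong expo_cong) auto

text \<open>This is \<open>rot_\<pi>_letter\<close> at each position before \<open>i\<close>; the
  bound \<open>i \<le> length w\<close> keeps these positions inside the word, where
  \<open>nth_act\<close> applies.\<close>

lemma unhit_act:
  assumes "s \<in> {1..n}" "i \<le> length w"
  shows "unhit k s (act k F p w) i m \<longleftrightarrow> unhit k s w i (m + p)"
  using assms by (auto simp: unhit_def nth_act rot_\<pi>_letter)

lemma finite_shift_support:
  fixes G :: "int \<Rightarrow> int"
  assumes "finite {m. G m \<noteq> 0}"
  shows "finite {m. G (m - p) \<noteq> 0}"
proof -
  have "{m. G (m - p) \<noteq> 0} = (\<lambda>m. m + p) ` {m. G m \<noteq> 0}"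
    by (auto simp: image_iff) (metis diff_add_cancel)
  then show ?thesis
    using assms by simp
qed

text \<open>The second factor sees letters already rotated by \<open>p\<close>. By
  \<open>unhit_act\<close> its lamp at \<open>m\<close> behaves like one at \<open>m + p\<close>,
  which after reindexing is the term \<open>G s (m - p)\<close>. This is the multiplication of the
  lamplighter group.\<close>

lemma act_act:
  assumes F: "\<And>s. s \<in> {1..n} \<Longrightarrow> finite {m. F s m \<noteq> 0}"
    and G: "\<And>s. s \<in> {1..n} \<Longrightarrow> finite {m. G s m \<noteq> 0}"
  shows "act k G q (act k F p w) = act k (\<lambda>s m. F s m + G s (m - p)) (p + q) w"
proof (rule nth_equalityI)
  fix i assume "i < length (act k G q (act k F p w))"
  then have i: "i < length w" by simp
  have "expo k F w i s + expo k G (act k F p w) i s = expo k (\<lambda>s m. F s m + G s (m - p)) w i s"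
    if s: "s \<in> {1..n}" for s
  proof -
    have "expo k G (act k F p w) i s = (\<Sum>m. if unhit k s w i (m + p) then G s m else 0)"
      unfolding expo_def using s i by (simp add: unhit_act)
    also have "\<dots> = (\<Sum>m. if unhit k s w i m then G s (m - p) else 0)"
      by (rule Sum_any.reindex_cong[where l = "\<lambda>m. m - p"])
         (auto intro!: bij_betw_byWitness[where f' = "\<lambda>m. m + p"])
    finally have G': "expo k G (act k F p w) i s = (\<Sum>m. if unhit k s w i m then G s (m - p) else 0)" .
    have "expo k F w i s + expo k G (act k F p w) i s =
        (\<Sum>m. (if unhit k s w i m then F s m else 0) + (if unhit k s w i m then G s (m - p) else 0))"
      unfolding G' unfolding expo_def using F[OF s] finite_shift_support[OF G[OF s], of p]
      by (intro Sum_any.distrib[symmetric]; elim rev_finite_subset) auto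
    also have "\<dots> = expo k (\<lambda>s m. F s m + G s (m - p)) w i s"
      unfolding expo_def by (intro Sum_any.cong) auto
    finally show ?thesis .
  qed
  then show "act k G q (act k F p w) ! i = act k (\<lambda>s m. F s m + G s (m - p)) (p + q) w ! i"
    using i by (auto simp: nth_act letter_letter intro!: letter_cong)
qed simp

lemma act_0: "act k (\<lambda>_ _. 0) 0 w = w"
  by (auto intro!: nth_equalityI simp: nth_act expo_def[abs_def] letter_0)

lemma bij_betw_act:
  assumes "\<And>s. s \<in> {1..n} \<Longrightarrow> finite {m. F s m \<noteq> 0}"
  shows "bij_betw (act k F p) (words (shift_seq k X)) (words (shift_seq k X))"
proof -
  \<comment> \<open>The inverse of \<open>(F, p)\<close>: in \<open>act_act\<close> the exponents
    cancel if \<open>G s (m - p) = - F s m\<close>.\<close>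
  let ?G = "\<lambda>s m. - F s (m + p)"
  have "finite {m. ?G s m \<noteq> 0}" if "s \<in> {1..n}" for s
    using finite_shift_support[OF assms[OF that], of "- p"] by simp
  then have "act k ?G (- p) (act k F p w) = w" "act k F p (act k ?G (- p) w) = w" for w
    using act_act[of F ?G k "- p" p w] act_act[of ?G F k p "- p" w] assms
    by (simp_all add: act_0)
  then show ?thesis
    by (intro bij_betw_byWitness[where f' = "act k ?G (- p)"]) (auto simp: act_in_words)
qed

section \<open>Faithfulness from every starting level\<close>

lemma act_eq_id_imp_shift_0:
  assumes "\<And>w. w \<in> words (shift_seq k X) \<Longrightarrow> act k F p w = w"
  shows "p = 0"
proof -
  obtain s where s: "s \<in> {1..n}"
    using n_pos by force
  \<comment> \<open>This cycle is longer than \<open>\<bar>p\<bar>\<close>, so rotation by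
    \<open>p\<close> fixes a letter on it only if \<open>p = 0\<close>.\<close>
  obtain i where i: "k \<le> i" "nat \<bar>p\<bar> < length (\<pi> s i)"
    using \<pi>_unbounded[OF s] by blast
  \<comment> \<open>A word of letters on \<pi>-cycles that just reaches level \<open>i\<close>: its
    last index is \<open>i - k\<close>.\<close>
  define w where "w = map (\<lambda>j. x s (k + j)) [0..<Suc (i - k)]"
  have "x s j \<in> X j" for j
    using x_in[OF s] \<pi>_cycle[OF s] by blast
  then have "w \<in> words (shift_seq k X)"
    by (auto simp: words_def shift_seq_def w_def simp del: upt_Suc)
  then have "act k F p w ! (i - k) = w ! (i - k)"
    using assms by simp
  then have "rot (\<pi> s i) p (x s i) = x s i"
    using i by (simp add: nth_act w_def letter_\<pi>[OF s x_in[OF s]] del: upt_Suc)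
  then have "int (length (\<pi> s i)) dvd p"
    using \<pi>_cycle[OF s, of i] x_in[OF s, of i] by (simp add: rot_fixed_iff)
  then show ?thesis
    using i(2) dvd_imp_le_int[of p "int (length (\<pi> s i))"] by linarith
qed

text \<open>
  All exponents \<open>F s m\<close> contribute on a word of \<open>\<sigma> s\<close>-letters; changing one letter to a letter
  on a sufficiently long \<open>\<pi> s\<close>-cycle removes exactly one of them from the sum.
\<close>

lemma act_eq_id_imp_dvd:
  assumes fin: "finite {m. F s m \<noteq> 0}" and s: "s \<in> {1..n}"
    and id: "\<And>w. w \<in> words (shift_seq k X) \<Longrightarrow> act k F p w = w"
  shows "R s dvd F s m0"
proof -
  \<comment> \<open>\<open>m0\<close> is inserted so that it belongs to \<open>M\<close> even if
    \<open>F s m0 = 0\<close>.\<close>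
  define M where "M = insert m0 {m. F s m \<noteq> 0}"
  have M: "finite M" "{m. F s m \<noteq> 0} \<subseteq> M" "m0 \<in> M"
    using fin by (auto simp: M_def)
  define B where "B = Max (abs ` M)"
  have B: "\<bar>m\<bar> \<le> B" if "m \<in> M" for m
    using M that by (simp add: B_def)
  \<comment> \<open>Members of \<open>M\<close> differ by at most \<open>2 * B\<close>, so a longer
    cycle separates their residues.\<close>
  obtain j where j: "k \<le> j" "nat (2 * B) < length (\<pi> s j)"
    using \<pi>_unbounded[OF s] by blast
  define c where "c i = hd (\<sigma> s i)" for i
  have c: "c i \<in> set (\<sigma> s i)" "c i \<in> X i" "c i \<notin> set (\<pi> s i)" for i
    using \<sigma>_cycle[OF s, of i] \<pi>\<sigma>_disj[OF s s, of i] hd_in_set[of "\<sigma> s i"] by (auto simp: c_def)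
  \<comment> \<open>The letter that rotation by \<open>m0\<close> takes to \<open>x s j\<close>; by
    the choice of \<open>j\<close>, rotation by another member of \<open>M\<close> takes it
    elsewhere.\<close>
  define y where "y = rot (\<pi> s j) (- m0) (x s j)"
  have y: "y \<in> X j"
    using \<pi>_cycle[OF s, of j] x_in[OF s, of j] rot_in_set_iff[of "\<pi> s j" "- m0" "x s j"]
    by (auto simp: y_def)
  have hit: "rot (\<pi> s j) m y = x s j \<longleftrightarrow> m = m0" if "m \<in> M" for m
  proof -
    have "rot (\<pi> s j) m y = x s j \<longleftrightarrow> rot (\<pi> s j) (m - m0) (x s j) = x s j"
      using \<pi>_cycle[OF s, of j] by (simp add: y_def rot_rot)
    also have "\<dots> \<longleftrightarrow> int (length (\<pi> s j)) dvd m - m0"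
      using \<pi>_cycle[OF s, of j] x_in[OF s, of j] by (simp add: rot_fixed_iff)
    also have "\<dots> \<longleftrightarrow> m = m0"
    proof
      assume "int (length (\<pi> s j)) dvd m - m0"
      moreover have "\<bar>m - m0\<bar> < int (length (\<pi> s j))"
        using B[OF that] B[OF M(3)] j(2) by linarith
      ultimately show "m = m0"
        using dvd_imp_le_int[of "m - m0" "int (length (\<pi> s j))"] by linarith
    qed simp
    finally show ?thesis .
  qed
  \<comment> \<open>Beyond level \<open>j\<close> the letter changed at \<open>j\<close> precedes
    the observed one. Divisibility on this tail is what \<open>R_dvdI\<close> asks for.\<close>
  have "int (length (\<sigma> s i)) dvd F s m0" if ij: "j < i" for i
  proof -
    define l where "l = i - k"
    have l: "k + l = i" "j - k < l"
      using ij j by (auto simp: l_def)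
    have dvd: "int (length (\<sigma> s i)) dvd expo k F u l s"
      if u: "u \<in> words (shift_seq k X)" "length u = Suc l" "u ! l = c i" for u
    proof -
      have "letter i p (expo k F u l) (c i) = c i"
        using id[OF u(1)] u l by (metis lessI nth_act)
      then have "rot (\<sigma> s i) (expo k F u l s) (c i) = c i"
        using \<sigma>_cycle[OF s, of i] by (simp add: letter_\<sigma>[OF s c(1)])
      then show ?thesis
        using \<sigma>_cycle[OF s, of i] c(1)[of i] by (simp add: rot_fixed_iff)
    qed
    define u where "u = map (\<lambda>t. c (k + t)) [0..<Suc l]"
    \<comment> \<open>Index \<open>j - k\<close> of the word lies at level \<open>j\<close>.\<close>
    define v where "v = u[j - k := y]"
    have len: "length u = Suc l" "length v = Suc l"
      by (simp_all add: u_def v_def)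
    have nth_u: "u ! t = c (k + t)" if "t \<le> l" for t
      using that by (simp add: u_def del: upt_Suc)
    have nth_v: "v ! t = (if t = j - k then y else c (k + t))" if "t \<le> l" for t
      using that len by (simp add: v_def nth_list_update nth_u)
    have u: "u \<in> words (shift_seq k X)"
      using c(2) by (auto simp: words_def shift_seq_def len nth_u)
    have v: "v \<in> words (shift_seq k X)"
      using c(2) y j(1) by (auto simp: words_def shift_seq_def len nth_v)
    have c_miss: "rot (\<pi> s t) m (c t) \<noteq> x s t" for t m
      using c(3)[of t] x_in[OF s, of t] by auto
    have "unhit k s u l m" for m
      using c_miss by (auto simp: unhit_def nth_u)
    then have "expo k F u l s = (\<Sum>m \<in> M. F s m)"
      using M by (simp add: expo_superset[where F = F and s = s, OF M(1,2)])
    moreover have "unhit k s v l m \<longleftrightarrow> m \<noteq> m0" if "m \<in> M" for m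
      using c_miss hit[OF that] l(2) j(1) by (auto simp: unhit_def nth_v)
    then have "expo k F v l s = (\<Sum>m \<in> M. if m \<noteq> m0 then F s m else 0)"
      by (simp add: expo_superset[where F = F and s = s, OF M(1,2)] cong: sum.cong)
    moreover have "(\<Sum>m \<in> M. if m \<noteq> m0 then F s m else 0) = (\<Sum>m \<in> M - {m0}. F s m)"
      using M(1) by (intro sum.mono_neutral_cong_right) auto
    ultimately have "expo k F u l s - expo k F v l s = F s m0"
      using M by (simp add: sum.remove)
    moreover have "int (length (\<sigma> s i)) dvd expo k F u l s - expo k F v l s"
      using u v l by (intro dvd_diff dvd) (auto simp: len nth_u nth_v)
    ultimately show ?thesis
      by simp
  qed
  then show ?thesis
    using R_dvdI[OF s] by blast
qed

section \<open>Lamps and letter permutations of the generators\<close>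

definition lamp :: "nat \<Rightarrow> nat \<Rightarrow> int \<Rightarrow> int" where
  "lamp s t m = (if t = s \<and> m = 0 then 1 else 0)"

lemma finite_lamp [simp]: "finite {m. lamp s t m \<noteq> 0}"
  by (rule finite_subset[of _ "{0}"]) (auto simp: lamp_def)

lemma expo_lamp: "expo k (lamp s) w i t = (if t = s \<and> unhit k s w i 0 then 1 else 0)"
  by (subst expo_superset[of "{0}"]) (auto simp: lamp_def)

lemma letter_\<pi>_product: "perm_prod n (\<lambda>s. cycle_of_list (\<pi> s i)) y = letter i 1 (\<lambda>_. 0) y"
proof (cases rule: letter_cases[where y = y and i = i])
  case (pi s)
  then show ?thesis
    using perm_prod_cycles_inside[OF \<pi>_disj] \<pi>_cycle[of s i] by (simp add: rot_1)
next
  case (sigma s)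
  then have "y \<notin> set (\<pi> t i)" if "t \<in> {1..n}" for t
    using \<pi>\<sigma>_disj[OF that, of s i] by blast
  then have "perm_prod n (\<lambda>s. cycle_of_list (\<pi> s i)) y = y"
    by (rule perm_prod_cycles_outside)
  then show ?thesis
    using sigma \<sigma>_cycle[of s i] by simp
next
  case outside
  then show ?thesis
    using perm_prod_cycles_outside[of n y "\<lambda>s. \<pi> s i"] by simp
qed

lemma letter_\<sigma>_cycle:
  assumes s: "s \<in> {1..n}"
  shows "cycle_of_list (\<sigma> s i) y = letter i 0 (\<lambda>t. if t = s then 1 else 0) y"
proof (cases rule: letter_cases[where y = y and i = i])
  case (pi t)
  then have "y \<notin> set (\<sigma> s i)"
    using \<pi>\<sigma>_disj[OF pi(1) s, of i] by blast
  then show ?thesis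
    using pi \<pi>_cycle[of t i] by (simp add: id_outside_supp)
next
  case (sigma t)
  show ?thesis
  proof (cases "t = s")
    case False
    then have "y \<notin> set (\<sigma> s i)"
      using disjoint_family_onD[OF \<sigma>_disj[of i] sigma(1) s] sigma by blast
    then show ?thesis
      using sigma False \<sigma>_cycle[of t i] by (simp add: id_outside_supp)
  qed (use sigma \<sigma>_cycle[of s i] in \<open>simp add: rot_1\<close>)
next
  case outside
  then show ?thesis
    using s by (simp add: id_outside_supp)
qed

end

section \<open>The automaton expressed by the action\<close>

locale lamp_automaton = lamp_cycles n X \<pi> \<sigma> x R
  for n X and \<pi> \<sigma> :: "nat \<Rightarrow> nat \<Rightarrow> 'x list" and x R +
  fixes a :: 'q and b :: "nat \<Rightarrow> 'q" and A :: "('q, 'x) tv_automaton"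
  assumes finite_X: "finite (X i)"
    and b_inj: "inj_on b {1..n}"
    and a_notin: "a \<notin> b ` {1..n}"
    and A_alphabet: "alphabet A = X"
    and A_states: "states A = insert a (b ` {1..n})"
    and A_trans: "q \<in> states A \<Longrightarrow> y \<in> X i \<Longrightarrow>
      trans_fun A i q y = (if \<exists>s \<in> {1..n}. q = b s \<and> y = x s i then a else q)"
    and A_out_a: "y \<in> X i \<Longrightarrow> out_fun A i a y = letter i 1 (\<lambda>_. 0) y"
    and A_out_b: "s \<in> {1..n} \<Longrightarrow> y \<in> X i \<Longrightarrow>
      out_fun A i (b s) y = letter i 1 (\<lambda>t. if t = s then 1 else 0) y"
begin

lemma trans_a: "y \<in> X i \<Longrightarrow> trans_fun A i a y = a"
  using a_notin by (simp add: A_trans A_states)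

lemma trans_b:
  assumes "s \<in> {1..n}" "y \<in> X i"
  shows "trans_fun A i (b s) y = (if y = x s i then a else b s)"
proof -
  have "(\<exists>t \<in> {1..n}. b s = b t \<and> y = x t i) \<longleftrightarrow> y = x s i"
    using assms b_inj by (auto dest: inj_onD)
  then show ?thesis
    using assms by (simp add: A_trans A_states)
qed

lemma out_bij:
  assumes "q \<in> states A"
  shows "bij_betw (out_fun A i q) (X i) (X i)"
proof -
  obtain e where e: "\<And>y. y \<in> X i \<Longrightarrow> out_fun A i q y = letter i 1 e y"
    using assms A_out_a A_out_b by (auto simp: A_states)
  have "bij_betw (letter i 1 e) (X i) (X i)"
    by (rule bij_betw_byWitness[where f' = "letter i (- 1) (\<lambda>s. - e s)"])
       (auto simp: letter_letter letter_0 letter_in)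
  then show ?thesis
    using e by (simp cong: bij_betw_cong)
qed

lemma is_tv_automaton: "is_tv_automaton A"
  unfolding is_tv_automaton_def A_alphabet
proof (intro conjI allI ballI)
  fix i q y assume q: "q \<in> states A" and y: "y \<in> X i"
  show "trans_fun A i q y \<in> states A"
    using q y by (simp add: A_trans) (simp add: A_states)
  show "out_fun A i q y \<in> X i"
    using out_bij[OF q] y by (rule bij_betw_apply)
qed (simp_all add: finite_X A_states)

lemma invertible: "invertible_automaton A"
  using out_bij by (simp add: invertible_automaton_def A_alphabet)

lemma length_run [simp]: "length (run A k q w) = length w"
  by (induction w arbitrary: k q) auto

lemma nth_run_a:
  assumes "w \<in> words (shift_seq k X)" "i < length w"
  shows "run A k a w ! i = letter (k + i) 1 (\<lambda>_. 0) (w ! i)"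
  using assms
proof (induction w arbitrary: k i)
  case (Cons y w)
  show ?case
  proof (cases i)
    case (Suc j)
    then show ?thesis using Cons.prems Cons.IH[of "Suc k" j] by (simp add: trans_a)
  qed (use Cons.prems in \<open>simp add: A_out_a\<close>)
qed simp

text \<open>The state is \<open>b s\<close> until the first letter \<open>x s\<close> has been read,
  and \<open>a\<close> from then on. That letter itself is still read in state \<open>b s\<close>,
  which is why \<open>unhit\<close> tests strictly earlier positions.\<close>

lemma nth_run_b:
  assumes "s \<in> {1..n}" "w \<in> words (shift_seq k X)" "i < length w"
  shows "run A k (b s) w ! i =
    letter (k + i) 1 (\<lambda>t. if t = s \<and> unhit k s w i 0 then 1 else 0) (w ! i)"
  using assms(2,3)
proof (induction w arbitrary: k i)
  case (Cons y w)
  show ?case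
  proof (cases i)
    case 0
    then show ?thesis using Cons.prems assms(1) by (simp add: A_out_b unhit_def)
  next
    case (Suc j)
    \<comment> \<open>Rotation by 0 is the identity, so \<open>unhit\<close> compares the letters
      themselves with \<open>x s\<close>; the first one decides the next state.\<close>
    have unhit: "unhit k s (y # w) (Suc j) 0 \<longleftrightarrow> y \<noteq> x s k \<and> unhit (Suc k) s w j 0"
      using \<pi>_cycle[OF assms(1)] by (auto simp: unhit_def less_Suc_eq_0_disj)
    show ?thesis
      using Suc Cons.prems assms(1) Cons.IH[of "Suc k" j] nth_run_a[of w "Suc k" j]
      by (simp add: trans_b unhit)
  qed
qed simp

lemma transf_a: "transf A k a = restrict (act k (\<lambda>_ _. 0) 1) (words (shift_seq k X))"
proof -
  have "run A k a w = act k (\<lambda>_ _. 0) 1 w" if "w \<in> words (shift_seq k X)" for w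
    using that by (intro nth_equalityI) (simp_all add: nth_run_a nth_act expo_def[abs_def])
  then show ?thesis
    by (auto simp: transf_def A_alphabet)
qed

text \<open>In right action notation \<open>b_s = c_s a\<close>: one lamp at 0, followed by the
  shift by 1.\<close>

lemma transf_b:
  assumes "s \<in> {1..n}"
  shows "transf A k (b s) = restrict (act k (lamp s) 1) (words (shift_seq k X))"
proof -
  have "run A k (b s) w = act k (lamp s) 1 w" if "w \<in> words (shift_seq k X)" for w
    using that assms by (intro nth_equalityI) (simp_all add: nth_run_b nth_act expo_lamp[abs_def])
  then show ?thesis
    by (auto simp: transf_def A_alphabet)
qed

end

section \<open>Generators of the lamplighter group\<close>

text \<open>The components of an element of \<open>K\<close> along the cyclic factors, as integers.
  They add only modulo \<open>R s\<close>, but \<open>coord_one\<close> is an exact equation: it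
  keeps supports finite when a configuration is read in coordinates.\<close>

locale group_coordinates = comm_group K
  for K :: "('k, 'm) monoid_scheme" (structure) +
  fixes n :: nat and R :: "nat \<Rightarrow> int" and coord :: "nat \<Rightarrow> 'k \<Rightarrow> int"
  assumes coord_one: "s \<in> {1..n} \<Longrightarrow> coord s \<one> = 0"
    and coord_mult: "s \<in> {1..n} \<Longrightarrow> g \<in> carrier K \<Longrightarrow> h \<in> carrier K \<Longrightarrow>
      [coord s (g \<otimes> h) = coord s g + coord s h] (mod R s)"
    and coord_eq_0: "g \<in> carrier K \<Longrightarrow> (\<And>s. s \<in> {1..n} \<Longrightarrow> R s dvd coord s g) \<Longrightarrow> g = \<one>"
    and coord_surj: "s \<in> {1..n} \<Longrightarrow>
      \<exists>g \<in> carrier K. \<forall>t \<in> {1..n}. [coord t g = (if t = s then 1 else 0)] (mod R t)"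
begin

definition unit :: "nat \<Rightarrow> 'k" where
  "unit s = (SOME g. g \<in> carrier K \<and> (\<forall>t \<in> {1..n}. [coord t g = (if t = s then 1 else 0)] (mod R t)))"

lemma unit:
  assumes "s \<in> {1..n}"
  shows "unit s \<in> carrier K"
    and "t \<in> {1..n} \<Longrightarrow> [coord t (unit s) = (if t = s then 1 else 0)] (mod R t)"
proof -
  have "unit s \<in> carrier K \<and> (\<forall>t \<in> {1..n}. [coord t (unit s) = (if t = s then 1 else 0)] (mod R t))"
    unfolding unit_def by (rule someI_ex) (use coord_surj[OF assms] in blast)
  then show "unit s \<in> carrier K"
    and "t \<in> {1..n} \<Longrightarrow> [coord t (unit s) = (if t = s then 1 else 0)] (mod R t)"
    by auto
qed

lemma coord_int_pow:
  fixes z :: int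
  assumes s: "s \<in> {1..n}" and g: "g \<in> carrier K"
  shows "[coord s (g [^] z) = z * coord s g] (mod R s)"
proof (induction z rule: int_induct[where k = 0])
  case base
  then show ?case using s by (simp add: coord_one)
next
  case (step1 i)
  have "[coord s (g [^] i \<otimes> g) = coord s (g [^] i) + coord s g] (mod R s)"
    using s g by (intro coord_mult) auto
  also have "[coord s (g [^] i) + coord s g = i * coord s g + coord s g] (mod R s)"
    using step1 by (intro cong_add) auto
  finally show ?case
    using g by (simp add: int_pow_mult distrib_right)
next
  case (step2 i)
  \<comment> \<open>Downwards, \<open>coord_mult\<close> is applied to this factorisation and solved
    for the coordinate of \<open>g [^] (i - 1)\<close>.\<close>
  have "g [^] i = g [^] (i - 1) \<otimes> g"
    using g int_pow_mult[OF g, of "i - 1" 1] by simp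
  then have "[coord s (g [^] i) = coord s (g [^] (i - 1)) + coord s g] (mod R s)"
    using s g by (simp add: coord_mult)
  with step2(2) have "[i * coord s g = coord s (g [^] (i - 1)) + coord s g] (mod R s)"
    by (metis cong_sym cong_trans)
  then have "[i * coord s g - coord s g = coord s (g [^] (i - 1)) + coord s g - coord s g] (mod R s)"
    by (intro cong_diff) auto
  then show ?case
    by (simp add: left_diff_distrib cong_sym_eq)
qed

text \<open>Coordinates are cleared from the top index down: a power of \<open>unit (Suc l)\<close>
  cancels coordinate \<open>Suc l\<close> and leaves the others unchanged modulo their
  \<open>R s\<close>. An element with all coordinates cleared is \<open>\<one>\<close>.\<close>

lemma generate_units: "generate K (unit ` {1..n}) = carrier K"
proof
  let ?H = "generate K (unit ` {1..n})"
  have units: "unit ` {1..n} \<subseteq> carrier K"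
    using unit by auto
  then show "?H \<subseteq> carrier K"
    by (rule generate_incl)
  have H: "subgroup ?H K"
    using units by (rule generate_is_subgroup)
  have "g \<in> ?H" if "g \<in> carrier K" "l \<le> n" "\<And>s. s \<in> {1..n} \<Longrightarrow> l < s \<Longrightarrow> R s dvd coord s g" for l g
    using that
  proof (induction l arbitrary: g)
    case 0
    then have "g = \<one>"
      by (intro coord_eq_0) auto
    then show ?case
      by (simp add: generate.one)
  next
    case (Suc l)
    let ?u = "unit (Suc l)"
    have l: "Suc l \<in> {1..n}"
      using Suc.prems by simp
    have u: "?u \<in> carrier K" "?u \<in> ?H"
      using unit(1)[OF l] l by (auto intro: generate.incl)
    have pow: "?u [^] (z :: int) \<in> ?H" for z
      using group.subgroup_int_pow_closed[OF is_group H u(2)] .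
    define h where "h = g \<otimes> ?u [^] (- coord (Suc l) g)"
    have "h \<in> ?H"
    proof (rule Suc.IH)
      show "h \<in> carrier K"
        using Suc.prems u by (simp add: h_def)
      fix s assume s: "s \<in> {1..n}" "l < s"
      have "[coord s h = coord s g + coord s (?u [^] (- coord (Suc l) g))] (mod R s)"
        unfolding h_def using Suc.prems u s by (intro coord_mult) auto
      also have "[coord s g + coord s (?u [^] (- coord (Suc l) g)) =
          coord s g + - coord (Suc l) g * coord s ?u] (mod R s)"
        using s u by (intro cong_add coord_int_pow) auto
      also have "[coord s g + - coord (Suc l) g * coord s ?u =
          coord s g + - coord (Suc l) g * (if s = Suc l then 1 else 0)] (mod R s)"
        using s unit(2)[OF l, of s] by (intro cong_add cong_mult) auto
      also have "[coord s g + - coord (Suc l) g * (if s = Suc l then 1 else 0) = 0] (mod R s)"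
        using Suc.prems(3)[of s] s by (auto simp: cong_0_iff)
      finally show "R s dvd coord s h"
        by (simp add: cong_0_iff)
    qed (use Suc.prems in simp)
    moreover have "g = h \<otimes> ?u [^] coord (Suc l) g"
      using Suc.prems u by (simp add: h_def m_assoc int_pow_neg)
    ultimately show ?case
      using subgroup.m_closed[OF H _ pow] by metis
  qed
  from this[of _ n] show "carrier K \<subseteq> ?H"
    by auto
qed

end

section \<open>Generating a wreath product with the integers\<close>

context group
begin

abbreviation "L \<equiv> lamplighter G"

lemma carrier_lamplighter:
  "carrier L = {f. (\<forall>i. f i \<in> carrier G) \<and> finite {i. f i \<noteq> \<one>}} \<times> UNIV"
  by (auto simp: lamplighter_def semidirect_def carrier_sum_group is_group PiE_iff)

lemma mult_lamplighter [simp]: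
  "(f, p) \<otimes>\<^bsub>L\<^esub> (g, q) = (\<lambda>i. f i \<otimes> g (i - p), p + q)"
  by (simp add: lamplighter_def semidirect_def restrict_UNIV)

lemma one_lamplighter [simp]: "\<one>\<^bsub>L\<^esub> = (\<lambda>_. \<one>, 0)"
  by (simp add: lamplighter_def semidirect_def restrict_UNIV)

definition single :: "int \<Rightarrow> 'a \<Rightarrow> int \<Rightarrow> 'a" where
  "single m g = (\<lambda>i. if i = m then g else \<one>)"

lemma single_in_lamplighter: "g \<in> carrier G \<Longrightarrow> (single m g, p) \<in> carrier L"
  by (auto simp: carrier_lamplighter single_def intro: finite_subset[of _ "{m}"])

text \<open>Dividing \<open>(single 0 g, 1)\<close> by the shift leaves a lamp at 0, conjugating by
  shifts moves it to any place, and finite products of lamps give every configuration.\<close>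

lemma generate_lamplighter:
  assumes S: "S \<subseteq> carrier G" "generate G S = carrier G"
  shows "generate L (insert (\<lambda>_. \<one>, 1) ((\<lambda>g. (single 0 g, 1)) ` S)) = carrier L"
proof
  interpret L: group L
    by (rule group_lamplighter) (rule is_group)
  let ?T = "insert (\<lambda>_. \<one>, 1) ((\<lambda>g. (single 0 g, 1)) ` S)"
  let ?H = "generate L ?T"
  have "(\<lambda>_. \<one>, 1) \<in> carrier L"
    by (simp add: carrier_lamplighter)
  then have T: "?T \<subseteq> carrier L"
    using S(1) by (auto intro: single_in_lamplighter)
  then show "?H \<subseteq> carrier L"
    by (rule L.generate_incl)
  have H: "subgroup ?H L"
    using T by (rule L.generate_is_subgroup)
  have inv_shift: "inv\<^bsub>L\<^esub> (\<lambda>_. \<one>, 1) = (\<lambda>_. \<one>, - 1)"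
    by (rule L.inv_equality) (auto simp: carrier_lamplighter)
  have up: "(\<lambda>_. \<one>, 1) \<in> ?H"
    by (simp add: generate.incl)
  have down: "(\<lambda>_. \<one>, - 1) \<in> ?H"
    using subgroup.m_inv_closed[OF H up] by (simp add: inv_shift)
  have shift: "(\<lambda>_. \<one>, p) \<in> ?H" for p :: int
  proof (induction p rule: int_induct[where k = 0])
    case base
    then show ?case using subgroup.one_closed[OF H] by simp
  next
    case (step1 i)
    then show ?case using subgroup.m_closed[OF H step1(2) up] by simp
  next
    case (step2 i)
    then show ?case using subgroup.m_closed[OF H step2(2) down] by simp
  qed
  have lamp0: "(single 0 g, 0) \<in> ?H" if "g \<in> carrier G" for g
  proof -
    \<comment> \<open>The values that a lamp at 0 can take inside \<open>?H\<close> form a subgroup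
      containing \<open>S\<close>, hence the whole group.\<close>
    let ?D = "{g \<in> carrier G. (single 0 g, 0) \<in> ?H}"
    have "S \<subseteq> ?D"
    proof
      fix g assume g: "g \<in> S"
      then have "(single 0 g, 1) \<in> ?H"
        by (simp add: generate.incl)
      moreover have "(single 0 g, 1) \<otimes>\<^bsub>L\<^esub> (\<lambda>_. \<one>, - 1) = (single 0 g, 0)"
        using g S(1) by (auto simp: single_def)
      ultimately have "(single 0 g, 0) \<in> ?H"
        using subgroup.m_closed[OF H _ down] by metis
      then show "g \<in> ?D"
        using g S(1) by auto
    qed
    moreover have "subgroup ?D G"
    proof (rule subgroupI)
      show "?D \<noteq> {}"
        using shift[of 0] by (auto simp: single_def intro!: exI[of _ \<one>])
    next
      fix g assume g: "g \<in> ?D"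
      have "inv\<^bsub>L\<^esub> (single 0 g, 0) = (single 0 (inv g), 0)"
        using g by (intro L.inv_equality single_in_lamplighter) (auto simp: single_def)
      then show "inv g \<in> ?D"
        using g subgroup.m_inv_closed[OF H, of "(single 0 g, 0)"] by simp
    next
      fix g h assume gh: "g \<in> ?D" "h \<in> ?D"
      have "(single 0 g, 0) \<otimes>\<^bsub>L\<^esub> (single 0 h, 0) = (single 0 (g \<otimes> h), 0)"
        by (auto simp: single_def)
      then show "g \<otimes> h \<in> ?D"
        using gh subgroup.m_closed[OF H, of "(single 0 g, 0)" "(single 0 h, 0)"] by simp
    qed auto
    ultimately have "carrier G \<subseteq> ?D"
      using generate_subgroup_incl[of S ?D] S(2) by simp
    then show ?thesis
      using that by blast
  qed
  have lamp: "(single m g, 0) \<in> ?H" if g: "g \<in> carrier G" for m g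
  proof -
    have "(\<lambda>_. \<one>, m) \<otimes>\<^bsub>L\<^esub> (single 0 g, 0) \<otimes>\<^bsub>L\<^esub> (\<lambda>_. \<one>, - m) = (single m g, 0)"
      using g by (auto simp: single_def)
    then show ?thesis
      using subgroup.m_closed[OF H subgroup.m_closed[OF H shift lamp0[OF g]] shift, of m "- m"] by simp
  qed
  \<comment> \<open>\<open>M\<close> only bounds the support, so each induction step can strip off
    one lamp, possibly a trivial one.\<close>
  have lamps: "(f, 0) \<in> ?H"
    if "finite M" "\<And>i. f i \<in> carrier G" "{i. f i \<noteq> \<one>} \<subseteq> M" for M f
    using that
  proof (induction M arbitrary: f rule: finite_induct)
    case empty
    then have "f = (\<lambda>_. \<one>)" by auto
    then show ?case using shift by simp
  next
    case (insert m M)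
    have "(f(m := \<one>), 0) \<in> ?H"
      using insert.prems by (intro insert.IH) auto
    moreover have "(single m (f m), 0) \<otimes>\<^bsub>L\<^esub> (f(m := \<one>), 0) = (f, 0)"
      using insert.prems by (auto simp: single_def)
    ultimately show ?case
      using subgroup.m_closed[OF H lamp[OF insert.prems(1)], of "(f(m := \<one>), 0)" m m] by metis
  qed
  show "carrier L \<subseteq> ?H"
  proof
    fix u assume "u \<in> carrier L"
    then obtain f p where u: "u = (f, p)" and f: "\<And>i. f i \<in> carrier G" "finite {i. f i \<noteq> \<one>}"
      by (auto simp: carrier_lamplighter)
    then have "(f, 0) \<otimes>\<^bsub>L\<^esub> (\<lambda>_. \<one>, p) = u"
      by simp
    then show "u \<in> ?H"
      using subgroup.m_closed[OF H lamps[OF f(2,1) subset_refl] shift, of p] by simp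
  qed
qed

end

section \<open>The automaton group\<close>

text \<open>A homomorphism carries a generated subgroup onto the one generated by the images; as
  \<open>S\<close> generates \<open>G\<close>, this is the whole range of \<open>h\<close>.\<close>

lemma iso_onto_subgroup_generated:
  assumes "group_hom G H h" "inj_on h (carrier G)" "S \<subseteq> carrier G" "generate G S = carrier G"
  shows "h \<in> iso G (subgroup_generated H (h ` S))"
proof -
  interpret group_hom G H h by fact
  have "h ` S \<subseteq> carrier H"
    using assms(3) by auto
  then have "carrier (subgroup_generated H (h ` S)) = h ` carrier G"
    using assms(3,4) generate_img[OF assms(3)] by (simp add: carrier_subgroup_generated Int_absorb1)
  then show ?thesis
    using assms(2) by (auto simp: iso_def hom_def bij_betw_def)
qed

section \<open>Isomorphisms from the lamplighter group onto the groups of all shifts\<close>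

locale lamp_action = lamp_automaton n X \<pi> \<sigma> x R a b A + group_coordinates K n R coord
  for n X and \<pi> \<sigma> :: "nat \<Rightarrow> nat \<Rightarrow> 'x list" and x R
    and a :: 'q and b :: "nat \<Rightarrow> 'q" and A :: "('q, 'x) tv_automaton"
    and K :: "('k, 'm) monoid_scheme" (structure) and coord :: "nat \<Rightarrow> 'k \<Rightarrow> int"
begin

text \<open>The configuration is read in integer coordinates and acts on words starting at level
  \<open>k\<close>. The domain does not depend on \<open>k\<close>, so the groups of different
  shifts can be compared through it.\<close>

definition \<Psi> :: "nat \<Rightarrow> (int \<Rightarrow> 'k) \<times> int \<Rightarrow> 'x list \<Rightarrow> 'x list" where
  "\<Psi> k = (\<lambda>(f, p). restrict (act k (\<lambda>s m. coord s (f m)) p) (words (shift_seq k X)))"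

lemma finite_coord:
  assumes "finite {m. f m \<noteq> \<one>}" "s \<in> {1..n}"
  shows "finite {m. coord s (f m) \<noteq> 0}"
  using assms(1) by (rule rev_finite_subset) (auto simp: coord_one[OF assms(2)])

lemma \<Psi>_hom: "\<Psi> k \<in> hom (lamplighter K) (word_group (shift_seq k X))"
proof (rule homI)
  fix u assume "u \<in> carrier (lamplighter K)"
  then obtain f p where u: "u = (f, p)" "finite {i. f i \<noteq> \<one>}"
    by (auto simp: carrier_lamplighter)
  then have "bij_betw (act k (\<lambda>s m. coord s (f m)) p) (words (shift_seq k X)) (words (shift_seq k X))"
    by (intro bij_betw_act finite_coord)
  then show "\<Psi> k u \<in> carrier (word_group (shift_seq k X))"
    by (simp add: u \<Psi>_def word_group_def Bij_def bij_betw_def inj_on_restrict_eq)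
next
  fix u v assume "u \<in> carrier (lamplighter K)" "v \<in> carrier (lamplighter K)"
  then obtain f p g q where uv: "u = (f, p)" "v = (g, q)"
    and f: "\<And>i. f i \<in> carrier K" "finite {i. f i \<noteq> \<one>}"
    and g: "\<And>i. g i \<in> carrier K" "finite {i. g i \<noteq> \<one>}"
    by (auto simp: carrier_lamplighter)
  let ?F = "\<lambda>s m. coord s (f m)" and ?G = "\<lambda>s m. coord s (g m)"
  let ?h = "\<lambda>m. f m \<otimes> g (m - p)"
  have "(f, p) \<otimes>\<^bsub>lamplighter K\<^esub> (g, q) \<in> carrier (lamplighter K)"
    using f g by (intro monoid.m_closed group.is_monoid group_lamplighter is_group)
      (auto simp: carrier_lamplighter)
  then have h: "finite {m. ?h m \<noteq> \<one>}"
    by (simp add: carrier_lamplighter)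
  \<comment> \<open>\<open>u\<close> acts first, as \<open>word_group\<close> multiplies from left
    to right.\<close>
  have "act k ?G q (act k ?F p w) = act k (\<lambda>s m. coord s (?h m)) (p + q) w" for w
  proof -
    have "act k ?G q (act k ?F p w) = act k (\<lambda>s m. ?F s m + ?G s (m - p)) (p + q) w"
      using f g by (intro act_act finite_coord)
    \<comment> \<open>Coordinates add only modulo \<open>R s\<close>, which \<open>act_cong\<close>
      absorbs.\<close>
    also have "\<dots> = act k (\<lambda>s m. coord s (?h m)) (p + q) w"
    proof (rule fun_cong[OF act_cong])
      fix s assume s: "s \<in> {1..n}"
      show "finite {m. coord s (?h m) \<noteq> 0}"
        using h s by (rule finite_coord)
      have "finite ({m. ?F s m \<noteq> 0} \<union> {m. ?G s (m - p) \<noteq> 0})"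
        using finite_coord[OF f(2) s] finite_shift_support[OF finite_coord[OF g(2) s], of p] by simp
      then show "finite {m. ?F s m + ?G s (m - p) \<noteq> 0}"
        by (rule rev_finite_subset) auto
      show "[?F s m + ?G s (m - p) = coord s (?h m)] (mod R s)" for m
        using coord_mult[OF s f(1) g(1)] by (rule cong_sym)
    qed
    finally show ?thesis .
  qed
  then show "\<Psi> k (u \<otimes>\<^bsub>lamplighter K\<^esub> v) = \<Psi> k u \<otimes>\<^bsub>word_group (shift_seq k X)\<^esub> \<Psi> k v"
    by (auto simp: uv \<Psi>_def word_group_def compose_def act_in_words)
qed

lemma group_hom_\<Psi>: "group_hom (lamplighter K) (word_group (shift_seq k X)) (\<Psi> k)"
  using \<Psi>_hom group_lamplighter[OF is_group] group_word_group
  by (simp add: group_hom_def group_hom_axioms_def)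

text \<open>For a kernel element the shift vanishes by \<open>act_eq_id_imp_shift_0\<close>. By
  \<open>act_eq_id_imp_dvd\<close> all coordinates of each lamp are then divisible by their moduli,
  so the lamp is trivial by \<open>coord_eq_0\<close>.\<close>

lemma inj_\<Psi>: "inj_on (\<Psi> k) (carrier (lamplighter K))"
proof -
  interpret \<Psi>: group_hom "lamplighter K" "word_group (shift_seq k X)" "\<Psi> k"
    by (rule group_hom_\<Psi>)
  have "u = \<one>\<^bsub>lamplighter K\<^esub>"
    if u: "u \<in> carrier (lamplighter K)" "\<Psi> k u = \<one>\<^bsub>word_group (shift_seq k X)\<^esub>" for u
  proof -
    obtain f p where fp: "u = (f, p)" "\<And>i. f i \<in> carrier K" "finite {i. f i \<noteq> \<one>}"
      using u(1) by (auto simp: carrier_lamplighter)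
    have id: "act k (\<lambda>s m. coord s (f m)) p w = w" if "w \<in> words (shift_seq k X)" for w
      using fun_cong[OF u(2), of w] that by (simp add: fp \<Psi>_def word_group_def)
    have "p = 0"
      using act_eq_id_imp_shift_0 id by blast
    moreover have "f m = \<one>" for m
    proof (rule coord_eq_0)
      fix s assume s: "s \<in> {1..n}"
      show "R s dvd coord s (f m)"
        using act_eq_id_imp_dvd[of "\<lambda>s m. coord s (f m)" s, OF finite_coord[OF fp(3) s] s id] .
    qed (rule fp)
    ultimately show ?thesis
      by (simp add: fp(1) fun_eq_iff)
  qed
  then show ?thesis
    by (simp add: \<Psi>.inj_on_one_iff)
qed

definition gens :: "((int \<Rightarrow> 'k) \<times> int) set" where
  "gens = insert (\<lambda>_. \<one>, 1) ((\<lambda>g. (single 0 g, 1)) ` unit ` {1..n})"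

lemma gens_in_lamplighter: "gens \<subseteq> carrier (lamplighter K)"
  by (auto simp: gens_def intro!: single_in_lamplighter unit) (simp add: carrier_lamplighter)

lemma \<Psi>_shift: "\<Psi> k (\<lambda>_. \<one>, 1) = transf A k a"
proof -
  have "act k (\<lambda>s m. coord s \<one>) 1 = act k (\<lambda>_ _. 0) 1"
    by (rule act_cong) (simp_all add: coord_one)
  then show ?thesis
    by (simp add: \<Psi>_def transf_a)
qed

lemma \<Psi>_lamp:
  assumes s: "s \<in> {1..n}"
  shows "\<Psi> k (single 0 (unit s), 1) = transf A k (b s)"
proof -
  have "finite {i. single 0 (unit s) i \<noteq> \<one>}"
    by (rule finite_subset[of _ "{0}"]) (auto simp: single_def)
  \<comment> \<open>\<open>unit s\<close> has the coordinates prescribed by \<open>lamp s\<close>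
    only up to congruence.\<close>
  then have "act k (\<lambda>t m. coord t (single 0 (unit s) m)) 1 = act k (lamp s) 1"
    by (intro act_cong finite_coord finite_lamp)
       (auto simp: single_def lamp_def coord_one intro: cong_trans[OF unit(2)[OF s]])
  then show ?thesis
    by (simp add: \<Psi>_def transf_b[OF s])
qed

lemma \<Psi>_gens: "\<Psi> k ` gens = transf A k ` states A"
  by (auto simp: gens_def A_states \<Psi>_shift \<Psi>_lamp image_image)

lemma \<Psi>_iso: "\<Psi> k \<in> iso (lamplighter K) (automaton_group (shift_automaton k A))"
proof -
  have "unit ` {1..n} \<subseteq> carrier K"
    using unit by auto
  then have "generate (lamplighter K) gens = carrier (lamplighter K)"
    unfolding gens_def using generate_units by (rule generate_lamplighter)
  then have "\<Psi> k \<in> iso (lamplighter K) (subgroup_generated (word_group (shift_seq k X)) (\<Psi> k ` gens))"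
    by (intro iso_onto_subgroup_generated group_hom_\<Psi> inj_\<Psi> gens_in_lamplighter)
  then show ?thesis
    by (simp add: \<Psi>_gens automaton_group_shift A_alphabet)
qed

lemma \<Psi>_0_iso: "\<Psi> 0 \<in> iso (lamplighter K) (automaton_group A)"
  using \<Psi>_iso[of 0] unfolding automaton_group_shift by (simp add: automaton_group_def)

text \<open>\<open>u\<close> is chosen before \<open>k\<close>: one element represents the state at
  all levels, as self-similarity demands.\<close>

lemma generator:
  assumes "q \<in> states A"
  obtains u where "u \<in> carrier (lamplighter K)" "\<And>k. \<Psi> k u = transf A k q"
proof -
  consider "q = a" | s where "s \<in> {1..n}" "q = b s"
    using assms by (auto simp: A_states)
  then show ?thesis
  proof cases
    case 1
    then show ?thesis
      using that[of "(\<lambda>_. \<one>, 1)"] gens_in_lamplighter by (simp add: \<Psi>_shift gens_def)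
  next
    case 2
    then show ?thesis
      using that[of "(single 0 (unit s), 1)"] single_in_lamplighter unit by (simp add: \<Psi>_lamp)
  qed
qed

lemma self_similar: "self_similar A"
  unfolding self_similar_def
proof (intro conjI allI is_tv_automaton invertible)
  fix k
  \<comment> \<open>The required isomorphism passes back through the lamplighter group and then
    applies \<open>\<Psi> 0\<close>.\<close>
  let ?inv = "inv_into (carrier (lamplighter K)) (\<Psi> k)"
  have "?inv \<in> iso (automaton_group (shift_automaton k A)) (lamplighter K)"
    using group_lamplighter[OF is_group] \<Psi>_iso by (rule group.iso_set_sym)
  then have "(\<Psi> 0 \<circ> ?inv)
      \<in> iso (automaton_group (shift_automaton k A)) (automaton_group A)"
    using \<Psi>_0_iso by (rule iso_set_trans)
  moreover have "(\<Psi> 0 \<circ> ?inv) (transf A k q)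
      = transf A 0 q" if q: "q \<in> states A" for q
  proof -
    obtain u where u: "u \<in> carrier (lamplighter K)" "\<And>k. \<Psi> k u = transf A k q"
      using generator[OF q] by blast
    then have "?inv (transf A k q) = u"
      using inv_into_f_f[OF inj_\<Psi> u(1), of k] by simp
    then show ?thesis
      by (simp add: u(2))
  qed
  ultimately show "\<exists>h \<in> iso (automaton_group (shift_automaton k A)) (automaton_group A).
      \<forall>q \<in> states A. h (transf A k q) = transf A 0 q"
    by blast
qed

lemma automaton_group_iso: "automaton_group A \<cong> lamplighter K"
  using group.iso_sym[OF group_lamplighter[OF is_group]] \<Psi>_0_iso unfolding is_iso_def by blast

end

section \<open>Coordinates from the cyclic decomposition\<close>

lemma (in comm_group) group_coordinates_exist:
  assumes r_pos: "\<forall>j \<in> {1..n2}. 0 < r j"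
    and decomp: "G \<cong> product_group {1..n1} (\<lambda>_. integer_group)
                        \<times>\<times> product_group {1..n2} (\<lambda>j. integer_mod_group (r j))"
  shows "\<exists>coord. group_coordinates G (n1 + n2) (\<lambda>s. if s \<le> n1 then 0 else int (r (s - n1))) coord"
proof -
  let ?P1 = "product_group {1..n1} (\<lambda>_. integer_group)"
  let ?P2 = "product_group {1..n2} (\<lambda>j. integer_mod_group (r j))"
  let ?R = "\<lambda>s. if s \<le> n1 then 0 else int (r (s - n1))"
  obtain \<kappa> where \<kappa>: "\<kappa> \<in> iso G (?P1 \<times>\<times> ?P2)"
    using decomp by (auto simp: is_iso_def)
  then have hom: "\<kappa> \<in> hom G (?P1 \<times>\<times> ?P2)" and bij: "bij_betw \<kappa> (carrier G) (carrier (?P1 \<times>\<times> ?P2))"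
    by (auto simp: iso_def)
  have grp: "group (?P1 \<times>\<times> ?P2)"
    by (intro DirProd_group product_group) simp_all
  have one: "\<kappa> \<one> = \<one>\<^bsub>?P1 \<times>\<times> ?P2\<^esub>"
    using hom_one[OF hom is_group grp] .
  have mult: "\<kappa> (g \<otimes> h) = \<kappa> g \<otimes>\<^bsub>?P1 \<times>\<times> ?P2\<^esub> \<kappa> h" if "g \<in> carrier G" "h \<in> carrier G" for g h
    using hom that by (rule hom_mult)
  have carr: "fst (\<kappa> g) \<in> ({1..n1} \<rightarrow>\<^sub>E UNIV)"
    "snd (\<kappa> g) \<in> (\<Pi>\<^sub>E j \<in> {1..n2}. carrier (integer_mod_group (r j)))" if "g \<in> carrier G" for g
    using hom_in_carrier[OF hom that] by (auto simp: mem_Times_iff)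
  \<comment> \<open>Indices up to \<open>n1\<close> belong to the infinite factors; the others,
    shifted by \<open>n1\<close>, to the finite ones, whose residues are read as integers.\<close>
  define coord where "coord s g = (if s \<le> n1 then fst (\<kappa> g) s else snd (\<kappa> g) (s - n1))" for s g
  have "group_coordinates G (n1 + n2) ?R coord"
  proof unfold_locales
    fix s assume s: "s \<in> {1..n1 + n2}"
    show "coord s \<one> = 0"
      using s by (auto simp: coord_def one)
    show "[coord s (g \<otimes> h) = coord s g + coord s h] (mod ?R s)"
      if "g \<in> carrier G" "h \<in> carrier G" for g h
      using s by (cases "\<kappa> g"; cases "\<kappa> h") (auto simp: coord_def mult[OF that] cong_def)
    \<comment> \<open>The image of the \<open>s\<close>-th standard generator. The reduction modulo
      \<open>r j\<close> matters for \<open>r j = 1\<close>, where the carrier contains only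
      0.\<close>
    define v where "v = ((\<lambda>i \<in> {1..n1}. if i = s then 1 else 0 :: int),
      (\<lambda>j \<in> {1..n2}. (if j + n1 = s then 1 else 0) mod int (r j)))"
    have "v \<in> carrier (?P1 \<times>\<times> ?P2)"
      using r_pos by (auto simp: v_def carrier_integer_mod_group)
    then obtain g where g: "g \<in> carrier G" "\<kappa> g = v"
      using bij by (metis bij_betw_def imageE)
    have "[coord t g = (if t = s then 1 else 0)] (mod ?R t)" if "t \<in> {1..n1 + n2}" for t
      using that by (auto simp: coord_def g v_def cong_def)
    with g show "\<exists>g \<in> carrier G. \<forall>t \<in> {1..n1 + n2}. [coord t g = (if t = s then 1 else 0)] (mod ?R t)"
      by blast
  next
    fix g assume g: "g \<in> carrier G"
      and dvd: "\<And>s. s \<in> {1..n1 + n2} \<Longrightarrow> ?R s dvd coord s g"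
    \<comment> \<open>The modulus is 0 here, and only 0 is divisible by 0.\<close>
    have "fst (\<kappa> g) i = 0" if "i \<in> {1..n1}" for i
      using dvd[of i] that by (simp add: coord_def)
    then have "fst (\<kappa> g) = \<one>\<^bsub>?P1\<^esub>"
      using carr(1)[OF g] by (intro extensionalityI[of _ "{1..n1}"]) (auto simp: PiE_iff)
    moreover have "snd (\<kappa> g) j = 0" if j: "j \<in> {1..n2}" for j
    proof -
      have "snd (\<kappa> g) j \<in> {0..<int (r j)}"
        using PiE_mem[OF carr(2)[OF g] j] bspec[OF r_pos j]
        by (simp add: carrier_integer_mod_group)
      moreover have "int (r j) dvd snd (\<kappa> g) j"
        using dvd[of "n1 + j"] j by (simp add: coord_def)
      ultimately show ?thesis
        using zdvd_not_zless by force
    qed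
    then have "snd (\<kappa> g) = \<one>\<^bsub>?P2\<^esub>"
      using carr(2)[OF g] by (intro extensionalityI[of _ "{1..n2}"]) (auto simp: PiE_iff)
    ultimately have "\<kappa> g = \<kappa> \<one>"
      by (simp add: one prod_eq_iff)
    then show "g = \<one>"
      using bij g by (auto simp: bij_betw_def dest: inj_onD)
  qed
  then show ?thesis
    by blast
qed

section \<open>Instantiation for the given cycles\<close>

lemma unbounded_beyond:
  fixes l :: "nat \<Rightarrow> nat"
  assumes "\<not> (\<exists>B. \<forall>i. l i \<le> B)"
  shows "\<exists>i\<ge>k. B < l i"
proof (rule ccontr)
  assume "\<not> (\<exists>i\<ge>k. B < l i)"
  \<comment> \<open>Each value before \<open>k\<close> is at most their sum, so a bound on the tail
    bounds the whole sequence.\<close>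
  then have "l i \<le> max B (\<Sum>j<k. l j)" for i
    by (cases "i < k") (auto simp: not_less le_max_iff_disj intro: member_le_sum)
  with assms show False
    by blast
qed

theorem theorem2:
  fixes K :: "('k, 'm) monoid_scheme"
    and n1 n2 n :: nat
    and r :: "nat \<Rightarrow> nat"
    and X :: "nat \<Rightarrow> 'x set"
    and \<pi> \<sigma> :: "nat \<Rightarrow> nat \<Rightarrow> 'x list"
    and x :: "nat \<Rightarrow> nat \<Rightarrow> 'x"
    and \<alpha> :: "nat \<Rightarrow> 'x \<Rightarrow> 'x"
    and \<beta> :: "nat \<Rightarrow> nat \<Rightarrow> 'x \<Rightarrow> 'x"
    and a :: 'q
    and b :: "nat \<Rightarrow> 'q"
    and A :: "('q, 'x) tv_automaton"
  assumes K: "comm_group K" "fin_gen_group K" "carrier K \<noteq> {\<one>\<^bsub>K\<^esub>}"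
    and r_pos: "\<forall>j \<in> {1..n2}. 0 < r j"
    and K_decomp: "K \<cong> product_group {1..n1} (\<lambda>_. integer_group)
                        \<times>\<times> product_group {1..n2} (\<lambda>j. integer_mod_group (r j))"
    and n: "n = n1 + n2" "n = group_rank K"
    and X: "\<forall>i. finite (X i)"
    and \<pi>_cycle: "\<forall>s \<in> {1..n}. \<forall>i. cycle (\<pi> s i) \<and> \<pi> s i \<noteq> [] \<and> set (\<pi> s i) \<subseteq> X i"
    and \<sigma>_cycle: "\<forall>s \<in> {1..n}. \<forall>i. cycle (\<sigma> s i) \<and> \<sigma> s i \<noteq> [] \<and> set (\<sigma> s i) \<subseteq> X i"
    and \<pi>_disj: "\<forall>i. disjoint_family_on (\<lambda>s. set (\<pi> s i)) {1..n}"
    and \<sigma>_disj: "\<forall>i. disjoint_family_on (\<lambda>s. set (\<sigma> s i)) {1..n}"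
    and \<pi>\<sigma>_disj: "\<forall>i. \<forall>s \<in> {1..n}. \<forall>t \<in> {1..n}. set (\<pi> s i) \<inter> set (\<sigma> t i) = {}"
    and \<pi>_unbounded: "\<forall>s \<in> {1..n}. \<not> (\<exists>B. \<forall>i. length (\<pi> s i) \<le> B)"
    and \<sigma>_unbounded: "\<forall>s \<in> {1..n1}. \<not> (\<exists>B. \<forall>i. length (\<sigma> s i) \<le> B)"
    and \<sigma>_length: "\<forall>s \<in> {n1<..n}. \<forall>i. length (\<sigma> s i) = r (s - n1)"
    and x: "\<forall>s \<in> {1..n}. \<forall>i. x s i \<in> set (\<pi> s i)"
    and \<alpha>: "\<forall>i. \<alpha> i = perm_prod n (\<lambda>s. cycle_of_list (\<pi> s i))"
    and \<beta>: "\<forall>s \<in> {1..n}. \<forall>i. \<beta> s i = \<alpha> i \<circ> cycle_of_list (\<sigma> s i)"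
    and distinct_states: "inj_on b {1..n}" "a \<notin> b ` {1..n}"
    and A_alphabet: "alphabet A = X"
    and A_states: "states A = insert a (b ` {1..n})"
    and A_trans: "\<forall>i. \<forall>q \<in> states A. \<forall>y \<in> X i.
                    trans_fun A i q y = (if \<exists>s \<in> {1..n}. q = b s \<and> y = x s i then a else q)"
    and A_out_a: "\<forall>i. \<forall>y \<in> X i. out_fun A i a y = \<alpha> i y"
    and A_out_b: "\<forall>s \<in> {1..n}. \<forall>i. \<forall>y \<in> X i. out_fun A i (b s) y = \<beta> s i y"
  shows "self_similar A \<and> automaton_group A \<cong> lamplighter K"
proof -
  let ?R = "\<lambda>s. if s \<le> n1 then 0 else int (r (s - n1))"
  obtain coord where "group_coordinates K n ?R coord"
    using comm_group.group_coordinates_exist[OF K(1) r_pos K_decomp] n(1) by blast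
  then interpret group_coordinates K n ?R coord .
  \<comment> \<open>With an empty index range \<open>coord_eq_0\<close> would make \<open>K\<close>
    trivial.\<close>
  have "0 < n"
  proof (rule ccontr)
    assume "\<not> 0 < n"
    then have "carrier K \<subseteq> {\<one>\<^bsub>K\<^esub>}"
      using coord_eq_0 by auto
    with K(3) show False
      by auto
  qed
  interpret lamp_cycles n X \<pi> \<sigma> x ?R
  proof unfold_locales
    show "0 < n" by fact
    show "s \<in> {1..n} \<Longrightarrow> distinct (\<pi> s i) \<and> set (\<pi> s i) \<subseteq> X i" for s i
      using \<pi>_cycle by blast
    show "s \<in> {1..n} \<Longrightarrow> distinct (\<sigma> s i) \<and> \<sigma> s i \<noteq> [] \<and> set (\<sigma> s i) \<subseteq> X i" for s i
      using \<sigma>_cycle by blast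
    show "disjoint_family_on (\<lambda>s. set (\<pi> s i)) {1..n}" "disjoint_family_on (\<lambda>s. set (\<sigma> s i)) {1..n}" for i
      using \<pi>_disj \<sigma>_disj by blast+
    show "s \<in> {1..n} \<Longrightarrow> t \<in> {1..n} \<Longrightarrow> set (\<pi> s i) \<inter> set (\<sigma> t i) = {}" for s t i
      using \<pi>\<sigma>_disj by blast
    show "s \<in> {1..n} \<Longrightarrow> x s i \<in> set (\<pi> s i)" for s i
      using x by blast
    show "s \<in> {1..n} \<Longrightarrow> \<exists>i\<ge>k. B < length (\<pi> s i)" for s k B
      using \<pi>_unbounded by (intro unbounded_beyond) blast
    \<comment> \<open>For \<open>s \<le> n1\<close> the modulus is 0, a multiple of every length;
      otherwise it equals the length.\<close>
    show "s \<in> {1..n} \<Longrightarrow> int (length (\<sigma> s i)) dvd ?R s" for s i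
      using \<sigma>_length by auto
    show "?R s dvd c"
      if s: "s \<in> {1..n}" and dvd: "\<And>i. k < i \<Longrightarrow> int (length (\<sigma> s i)) dvd c" for s k c
    proof (cases "s \<le> n1")
      case True
      with s have "s \<in> {1..n1}"
        by simp
      then have "\<not> (\<exists>B. \<forall>i. length (\<sigma> s i) \<le> B)"
        using \<sigma>_unbounded by blast
      \<comment> \<open>A cycle beyond level \<open>k\<close> that is longer than
        \<open>\<bar>c\<bar>\<close> and whose length divides \<open>c\<close> forces
        \<open>c = 0\<close>.\<close>
      from unbounded_beyond[OF this, of "Suc k" "nat \<bar>c\<bar>"]
      obtain i where "Suc k \<le> i" "nat \<bar>c\<bar> < length (\<sigma> s i)"
        by blast
      then have "c = 0"
        using dvd[of i] dvd_imp_le_int[of c "int (length (\<sigma> s i))"] by linarith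
      then show ?thesis
        by simp
    next
      case False
      then show ?thesis
        using s dvd[of "Suc k"] \<sigma>_length by simp
    qed
  qed
  interpret lamp_action n X \<pi> \<sigma> x ?R a b A K coord
  proof unfold_locales
    show "finite (X i)" for i
      using X by blast
    show "inj_on b {1..n}" "a \<notin> b ` {1..n}" "alphabet A = X" "states A = insert a (b ` {1..n})"
      by fact+
    show "trans_fun A i q y = (if \<exists>s \<in> {1..n}. q = b s \<and> y = x s i then a else q)"
      if "q \<in> states A" "y \<in> X i" for q y i
      using A_trans that by blast
    have letter_\<alpha>: "\<alpha> i y = letter i 1 (\<lambda>_. 0) y" for i y
      using \<alpha> by (simp add: letter_\<pi>_product)
    show "out_fun A i a y = letter i 1 (\<lambda>_. 0) y" if "y \<in> X i" for i y
      using A_out_a that by (simp add: letter_\<alpha>)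
    \<comment> \<open>\<open>\<beta>\<close> applies the \<sigma>-cycle first and
      \<open>\<alpha>\<close> second; by \<open>letter_letter\<close> the exponents add to rotation
      by 1 on the \<pi>-cycles and on the \<open>s\<close>-th \<sigma>-cycle.\<close>
    show "out_fun A i (b s) y = letter i 1 (\<lambda>t. if t = s then 1 else 0) y"
      if "s \<in> {1..n}" "y \<in> X i" for s i y
      using A_out_b \<beta> that by (simp add: letter_\<alpha> letter_\<sigma>_cycle letter_letter)
  qed
  show ?thesis
    using self_similar automaton_group_iso by blast
qed

end
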